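(* There exists a basis $\mathscr{B}$ of $c_0\oplus\ell^1\oplus\ell^2$ which is quasi-greedy, democratic, and satisfies $k_N(\mathscr{B})\approx\log N$; that is, there are constants $0<c_1\le c_2$ such that $c_1\log N\le k_N(\mathscr{B})\le c_2\log N$ for all integers $N\ge2$.
   Context: A basis means a Schauder basis $\mathscr{B}=\{\mathbf{e}_j\}_{j=1}^\infty$ of a Banach space $\mathbb{X}$ (scalars in $\mathbb{C}$), normalized so that $\|\mathbf{e}_j\|=1$. Every $x$ is written $x=\sum_j a_j(x)\mathbf{e}_j$. For $N\ge1$, $G_N(x)=\sum_{j\in\Lambda}a_j(x)\mathbf{e}_j$, where $\Lambda\subset\{1,2,\dots\}$ is any $N$-element set with $\min_{j\in\Lambda}|a_j(x)|\ge\max_{j\notin\Lambda}|a_j(x)|$. The basis is quasi-greedy if $\lim_{N\to\infty}\|x-G_N(x)\|=0$ for every $x$ and every choice of the $G_N$'s; equivalently, there is a constant $K$ with $\|G_N(x)\|\le K\|x\|$ for all $x$, all $N\ge1$ and all choices of $G_N$. The basis is democratic if there is $D$ with $\|\sum_{j\in A}\mathbf{e}_j\|\le D\|\sum_{j\in B}\mathbf{e}_j\|$ for all finite $A,B$ with $|A|=|B|$. For finite $A\subset\{1,2,\dots\}$, $S_A(x)=\sum_{j\in A}a_j(x)\mathbf{e}_j$, and $k_N(\mathscr{B})=\sup_{|A|\le N}\|S_A\|$. The direct sum carries any standard ($\ell^2$-type) direct sum norm. *)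

theory Defs
  imports "HOL-Analysis.Analysis"
begin

class complex_normed_vector = real_normed_vector +
  fixes scaleC :: "complex \<Rightarrow> 'a \<Rightarrow> 'a" (infixr "*\<^sub>C" 75)
  assumes scaleC_add_right: "c *\<^sub>C (x + y) = c *\<^sub>C x + c *\<^sub>C y"
    and scaleC_add_left: "(c + d) *\<^sub>C x = c *\<^sub>C x + d *\<^sub>C x"
    and scaleC_scaleC: "c *\<^sub>C d *\<^sub>C x = (c * d) *\<^sub>C x"
    and scaleR_scaleC: "r *\<^sub>R x = complex_of_real r *\<^sub>C x"
    and norm_scaleC: "norm (c *\<^sub>C x) = cmod c * norm x"

class complex_banach = complex_normed_vector + banach

text \<open>The library's norm on a product type is \<open>sqrt ((norm x)\<^sup>2 + (norm y)\<^sup>2)\<close>, i.e. the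
  \<open>\<ell>\<^sup>2\<close>-direct sum norm.\<close>

instantiation prod :: (complex_normed_vector, complex_normed_vector) complex_normed_vector
begin

definition scaleC_prod where "c *\<^sub>C p = (c *\<^sub>C fst p, c *\<^sub>C snd p)"

instance
proof
  fix c :: complex and x :: "'a \<times> 'b"
  show "norm (c *\<^sub>C x) = cmod c * norm x"
    by (simp add: scaleC_prod_def norm_prod_def norm_scaleC power_mult_distrib
        flip: distrib_left) (simp add: real_sqrt_mult)
qed (auto simp: scaleC_prod_def scaleC_add_right scaleC_add_left scaleC_scaleC scaleR_scaleC
      scaleR_prod_def)

end

instance prod :: (complex_banach, complex_banach) complex_banach ..

lemma ell2_partial_triangle:
  fixes a b :: "nat \<Rightarrow> complex"
  shows "L2_set (\<lambda>n. cmod (a n + b n)) A \<le> L2_set (\<lambda>n. cmod (a n)) A + L2_set (\<lambda>n. cmod (b n)) A"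
proof -
  have "L2_set (\<lambda>n. cmod (a n + b n)) A \<le> L2_set (\<lambda>n. cmod (a n) + cmod (b n)) A"
    by (intro L2_set_mono norm_triangle_ineq) auto
  also have "\<dots> \<le> L2_set (\<lambda>n. cmod (a n)) A + L2_set (\<lambda>n. cmod (b n)) A"
    by (rule L2_set_triangle_ineq)
  finally show ?thesis .
qed

lemma ell2_iff_bound:
  fixes a :: "nat \<Rightarrow> complex"
  assumes "C \<ge> 0"
  shows "(summable (\<lambda>n. (cmod (a n))\<^sup>2) \<and> sqrt (\<Sum>n. (cmod (a n))\<^sup>2) \<le> C) \<longleftrightarrow>
    (\<forall>K. L2_set (\<lambda>n. cmod (a n)) {..<K} \<le> C)"
proof
  assume *: "summable (\<lambda>n. (cmod (a n))\<^sup>2) \<and> sqrt (\<Sum>n. (cmod (a n))\<^sup>2) \<le> C"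
  show "\<forall>K. L2_set (\<lambda>n. cmod (a n)) {..<K} \<le> C"
  proof
    fix K
    have "L2_set (\<lambda>n. cmod (a n)) {..<K} \<le> sqrt (\<Sum>n. (cmod (a n))\<^sup>2)"
      unfolding L2_set_def using * by (intro real_sqrt_le_mono sum_le_suminf) auto
    with * show "L2_set (\<lambda>n. cmod (a n)) {..<K} \<le> C" by linarith
  qed
next
  assume *: "\<forall>K. L2_set (\<lambda>n. cmod (a n)) {..<K} \<le> C"
  have b: "(\<Sum>n<K. (cmod (a n))\<^sup>2) \<le> C\<^sup>2" for K
    using *[rule_format, of K] unfolding L2_set_def by (rule sqrt_le_D)
  have s: "summable (\<lambda>n. (cmod (a n))\<^sup>2)"
    by (rule summableI_nonneg_bounded[of _ "C\<^sup>2"]) (use b in auto)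
  have "(\<Sum>n. (cmod (a n))\<^sup>2) \<le> C\<^sup>2"
    by (rule suminf_le_const[OF s b])
  then show "summable (\<lambda>n. (cmod (a n))\<^sup>2) \<and> sqrt (\<Sum>n. (cmod (a n))\<^sup>2) \<le> C"
    using s assms by (simp add: real_le_lsqrt suminf_nonneg)
qed

lemma ell1_iff_bound:
  fixes a :: "nat \<Rightarrow> complex"
  shows "(summable (\<lambda>n. cmod (a n)) \<and> (\<Sum>n. cmod (a n)) \<le> C) \<longleftrightarrow>
    (\<forall>K. (\<Sum>n<K. cmod (a n)) \<le> C)"
proof
  assume "summable (\<lambda>n. cmod (a n)) \<and> (\<Sum>n. cmod (a n)) \<le> C"
  then show "\<forall>K. (\<Sum>n<K. cmod (a n)) \<le> C"
    by (meson finite_lessThan norm_ge_zero order_trans sum_le_suminf)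
next
  assume *: "\<forall>K. (\<Sum>n<K. cmod (a n)) \<le> C"
  have s: "summable (\<lambda>n. cmod (a n))"
    by (rule summableI_nonneg_bounded[of _ C]) (use * in auto)
  with * show "summable (\<lambda>n. cmod (a n)) \<and> (\<Sum>n. cmod (a n)) \<le> C"
    by (auto intro: suminf_le_const)
qed

lemma ell2_add:
  fixes a b :: "nat \<Rightarrow> complex"
  assumes "summable (\<lambda>n. (cmod (a n))\<^sup>2)" "summable (\<lambda>n. (cmod (b n))\<^sup>2)"
  shows "summable (\<lambda>n. (cmod (a n + b n))\<^sup>2) \<and>
    sqrt (\<Sum>n. (cmod (a n + b n))\<^sup>2) \<le> sqrt (\<Sum>n. (cmod (a n))\<^sup>2) + sqrt (\<Sum>n. (cmod (b n))\<^sup>2)"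
proof -
  have nn: "0 \<le> sqrt (\<Sum>n. (cmod (a n))\<^sup>2)" "0 \<le> sqrt (\<Sum>n. (cmod (b n))\<^sup>2)"
    using assms by (auto intro: suminf_nonneg)
  have A: "\<forall>K. L2_set (\<lambda>n. cmod (a n)) {..<K} \<le> sqrt (\<Sum>n. (cmod (a n))\<^sup>2)"
    using ell2_iff_bound[OF nn(1), of a] assms by simp
  have B: "\<forall>K. L2_set (\<lambda>n. cmod (b n)) {..<K} \<le> sqrt (\<Sum>n. (cmod (b n))\<^sup>2)"
    using ell2_iff_bound[OF nn(2), of b] assms by simp
  show ?thesis
    by (subst ell2_iff_bound)
      (use nn A B in \<open>auto intro!: order_trans[OF ell2_partial_triangle] add_mono\<close>)
qed

typedef c0 = "{a :: nat \<Rightarrow> complex. a \<longlonglongrightarrow> 0}"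
  morphisms c0_nth Abs_c0
  by (auto intro: exI[of _ "\<lambda>_. 0"])

typedef ell1 = "{a :: nat \<Rightarrow> complex. summable (\<lambda>n. cmod (a n))}"
  morphisms ell1_nth Abs_ell1
  by (auto intro: exI[of _ "\<lambda>_. 0"])

typedef ell2 = "{a :: nat \<Rightarrow> complex. summable (\<lambda>n. (cmod (a n))\<^sup>2)}"
  morphisms ell2_nth Abs_ell2
  by (auto intro: exI[of _ "\<lambda>_. 0"])

setup_lifting type_definition_c0
setup_lifting type_definition_ell1
setup_lifting type_definition_ell2

lemma c0_bdd: "(a :: nat \<Rightarrow> complex) \<longlonglongrightarrow> 0 \<Longrightarrow> bdd_above (range (\<lambda>n. cmod (a n)))"
  by (metis Bseq_eq_bounded bdd_above_norm convergentI convergent_imp_Bseq image_image)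

lemma c0_le_SUP: "(a :: nat \<Rightarrow> complex) \<longlonglongrightarrow> 0 \<Longrightarrow> cmod (a n) \<le> (SUP n. cmod (a n))"
  by (intro cSUP_upper c0_bdd) auto

instantiation c0 :: complex_normed_vector
begin

lift_definition zero_c0 :: c0 is "\<lambda>_. 0" by simp
lift_definition plus_c0 :: "c0 \<Rightarrow> c0 \<Rightarrow> c0" is "\<lambda>a b n. a n + b n"
  using tendsto_add_zero by blast
lift_definition minus_c0 :: "c0 \<Rightarrow> c0 \<Rightarrow> c0" is "\<lambda>a b n. a n - b n"
  using tendsto_diff by fastforce
lift_definition uminus_c0 :: "c0 \<Rightarrow> c0" is "\<lambda>a n. - a n"
  using tendsto_minus by fastforce
lift_definition scaleR_c0 :: "real \<Rightarrow> c0 \<Rightarrow> c0" is "\<lambda>r a n. complex_of_real r * a n"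
  by (rule tendsto_mult_right_zero)
lift_definition scaleC_c0 :: "complex \<Rightarrow> c0 \<Rightarrow> c0" is "\<lambda>c a n. c * a n"
  by (rule tendsto_mult_right_zero)
lift_definition norm_c0 :: "c0 \<Rightarrow> real" is "\<lambda>a. SUP n. cmod (a n)" .

definition dist_c0 :: "c0 \<Rightarrow> c0 \<Rightarrow> real" where "dist_c0 x y = norm (x - y)"
definition sgn_c0 :: "c0 \<Rightarrow> c0" where "sgn_c0 x = inverse (norm x) *\<^sub>R x"
definition uniformity_c0 :: "(c0 \<times> c0) filter" where
  "uniformity_c0 = (INF e\<in>{0<..}. principal {(x, y). dist x y < e})"
definition open_c0 :: "c0 set \<Rightarrow> bool" where
  "open_c0 U = (\<forall>x\<in>U. eventually (\<lambda>(x', y). x' = x \<longrightarrow> y \<in> U) uniformity)"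

instance
proof
  fix x y z :: c0 and r s :: real and c d :: complex and U :: "c0 set"
  show "dist x y = norm (x - y)" by (rule dist_c0_def)
  show "sgn x = inverse (norm x) *\<^sub>R x" by (rule sgn_c0_def)
  show "uniformity = (INF e\<in>{0<..}. principal {(x, y :: c0). dist x y < e})"
    by (rule uniformity_c0_def)
  show "open U = (\<forall>x\<in>U. eventually (\<lambda>(x', y). x' = x \<longrightarrow> y \<in> U) uniformity)"
    by (rule open_c0_def)
  show "(norm x = 0) = (x = 0)"
  proof transfer
    fix a :: "nat \<Rightarrow> complex" assume a: "a \<longlonglongrightarrow> 0"
    have "a = (\<lambda>_. 0)" if "(SUP n. cmod (a n)) = 0"
      using c0_le_SUP[OF a] that by (intro ext) simp
    then show "((SUP n. cmod (a n)) = 0) = (a = (\<lambda>_. 0))" by auto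
  qed
  show "norm (x + y) \<le> norm x + norm y"
    by transfer (auto intro!: cSUP_least order_trans[OF norm_triangle_ineq] add_mono c0_le_SUP)
  show n: "norm (c *\<^sub>C x) = cmod c * norm x" for c and x :: c0
  proof transfer
    fix c and a :: "nat \<Rightarrow> complex" assume a: "a \<longlonglongrightarrow> 0"
    show "(SUP n. cmod (c * a n)) = cmod c * (SUP n. cmod (a n))"
    proof (cases "c = 0")
      case False
      show ?thesis
      proof (rule antisym)
        show "(SUP n. cmod (c * a n)) \<le> cmod c * (SUP n. cmod (a n))"
          by (intro cSUP_least) (auto simp: norm_mult intro!: mult_left_mono c0_le_SUP a)
        have "(SUP n. cmod (a n)) \<le> (SUP n. cmod (c * a n)) / cmod c"
        proof (rule cSUP_least)
          fix n
          have "cmod (c * a n) \<le> (SUP n. cmod (c * a n))"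
            by (rule c0_le_SUP) (rule tendsto_mult_right_zero[OF a])
          then show "cmod (a n) \<le> (SUP n. cmod (c * a n)) / cmod c"
            using False by (simp add: norm_mult field_simps)
        qed simp
        then show "cmod c * (SUP n. cmod (a n)) \<le> (SUP n. cmod (c * a n))"
          using False by (simp add: field_simps)
      qed
    qed simp
  qed
  show rc: "r *\<^sub>R x = complex_of_real r *\<^sub>C x" for r and x :: c0 by transfer simp
  show "norm (r *\<^sub>R x) = \<bar>r\<bar> * norm x" by (simp add: rc n)
qed (transfer; auto simp: algebra_simps)+

end

lemma c0_nth_minus: "c0_nth (x - y) n = c0_nth x n - c0_nth y n"
  by transfer simp

lemma norm_c0_nth_le: "cmod (c0_nth x n) \<le> norm x"
  by transfer (rule c0_le_SUP)

lemma norm_c0_leI: "(\<And>n. cmod (c0_nth x n) \<le> C) \<Longrightarrow> norm x \<le> C"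
  by transfer (auto intro: cSUP_least)

instance c0 :: complex_banach
proof
  fix X :: "nat \<Rightarrow> c0" assume X: "Cauchy X"
  have "Cauchy (\<lambda>m. c0_nth (X m) n)" for n
  proof (rule metric_CauchyI)
    fix e :: real assume "e > 0"
    then obtain M where "\<forall>i\<ge>M. \<forall>j\<ge>M. dist (X i) (X j) < e" using metric_CauchyD[OF X] by blast
    then show "\<exists>M. \<forall>i\<ge>M. \<forall>j\<ge>M. dist (c0_nth (X i) n) (c0_nth (X j) n) < e"
      using norm_c0_nth_le[of "X i - X j" n for i j]
      by (metis c0_nth_minus dist_norm order_le_less_trans)
  qed
  then obtain l where l: "\<And>n. (\<lambda>m. c0_nth (X m) n) \<longlonglongrightarrow> l n"
    unfolding Cauchy_convergent_iff convergent_def by metis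
  have unif: "\<exists>M. \<forall>m\<ge>M. \<forall>n. cmod (c0_nth (X m) n - l n) \<le> e" if "e > 0" for e
  proof -
    obtain M where M: "\<forall>i\<ge>M. \<forall>j\<ge>M. dist (X i) (X j) < e"
      using metric_CauchyD[OF X \<open>e > 0\<close>] by blast
    have "cmod (c0_nth (X m) n - l n) \<le> e" if "m \<ge> M" for m n
    proof (rule tendsto_upperbound)
      show "(\<lambda>j. cmod (c0_nth (X m) n - c0_nth (X j) n)) \<longlonglongrightarrow> cmod (c0_nth (X m) n - l n)"
        by (intro tendsto_intros l)
      show "eventually (\<lambda>j. cmod (c0_nth (X m) n - c0_nth (X j) n) \<le> e) sequentially"
        using eventually_ge_at_top[of M]
      proof eventually_elim
        case (elim j)
        with M that have "norm (X m - X j) < e" by (simp add: dist_norm)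
        then show ?case using norm_c0_nth_le[of "X m - X j" n] by (simp add: c0_nth_minus)
      qed
    qed simp
    then show ?thesis by blast
  qed
  have "l \<longlonglongrightarrow> 0"
  proof (rule LIMSEQ_I)
    fix e :: real assume "e > 0"
    then obtain M where M: "\<And>n. cmod (c0_nth (X M) n - l n) \<le> e / 2"
      using unif[of "e/2"] by auto
    have "c0_nth (X M) \<longlonglongrightarrow> 0" using c0_nth by blast
    then obtain N where N: "\<And>n. n \<ge> N \<Longrightarrow> cmod (c0_nth (X M) n) < e / 2"
      using LIMSEQ_D[of "c0_nth (X M)" 0 "e/2"] \<open>e > 0\<close> by auto
    have "cmod (l n) < e" if "n \<ge> N" for n
      using N[OF that] M[of n] norm_triangle_ineq2[of "l n" "c0_nth (X M) n"]
      by (simp add: norm_minus_commute)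
    then show "\<exists>no. \<forall>n\<ge>no. cmod (l n - 0) < e" by auto
  qed
  then obtain L where L: "l = c0_nth L" by (metis Abs_c0_inverse mem_Collect_eq)
  have "X \<longlonglongrightarrow> L"
  proof (rule LIMSEQ_I)
    fix e :: real assume "e > 0"
    then obtain M where "\<forall>m\<ge>M. \<forall>n. cmod (c0_nth (X m) n - l n) \<le> e / 2"
      using unif[of "e/2"] by auto
    then have "norm (X m - L) \<le> e / 2" if "m \<ge> M" for m
      using that by (intro norm_c0_leI) (auto simp: c0_nth_minus L)
    then show "\<exists>M. \<forall>m\<ge>M. norm (X m - L) < e"
      using \<open>e > 0\<close> by (intro exI[of _ M]) fastforce
  qed
  then show "convergent X" by (rule convergentI)
qed

instantiation ell1 :: complex_normed_vector
begin

lift_definition zero_ell1 :: ell1 is "\<lambda>_. 0" by simp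
lift_definition plus_ell1 :: "ell1 \<Rightarrow> ell1 \<Rightarrow> ell1" is "\<lambda>a b n. a n + b n"
  subgoal for a b
    by (rule summable_comparison_test'[OF summable_add[of "\<lambda>n. cmod (a n)" "\<lambda>n. cmod (b n)"]])
      (auto intro: norm_triangle_ineq)
  done
lift_definition minus_ell1 :: "ell1 \<Rightarrow> ell1 \<Rightarrow> ell1" is "\<lambda>a b n. a n - b n"
  subgoal for a b
    by (rule summable_comparison_test'[OF summable_add[of "\<lambda>n. cmod (a n)" "\<lambda>n. cmod (b n)"]])
      (auto intro: norm_triangle_ineq4)
  done
lift_definition uminus_ell1 :: "ell1 \<Rightarrow> ell1" is "\<lambda>a n. - a n"
  by simp
lift_definition scaleR_ell1 :: "real \<Rightarrow> ell1 \<Rightarrow> ell1" is "\<lambda>r a n. complex_of_real r * a n"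
  by (simp add: norm_mult summable_mult)
lift_definition scaleC_ell1 :: "complex \<Rightarrow> ell1 \<Rightarrow> ell1" is "\<lambda>c a n. c * a n"
  by (simp add: norm_mult summable_mult)
lift_definition norm_ell1 :: "ell1 \<Rightarrow> real" is "\<lambda>a. \<Sum>n. cmod (a n)" .

definition dist_ell1 :: "ell1 \<Rightarrow> ell1 \<Rightarrow> real" where "dist_ell1 x y = norm (x - y)"
definition sgn_ell1 :: "ell1 \<Rightarrow> ell1" where "sgn_ell1 x = inverse (norm x) *\<^sub>R x"
definition uniformity_ell1 :: "(ell1 \<times> ell1) filter" where
  "uniformity_ell1 = (INF e\<in>{0<..}. principal {(x, y). dist x y < e})"
definition open_ell1 :: "ell1 set \<Rightarrow> bool" where
  "open_ell1 U = (\<forall>x\<in>U. eventually (\<lambda>(x', y). x' = x \<longrightarrow> y \<in> U) uniformity)"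

instance
proof
  fix x y z :: ell1 and r s :: real and c d :: complex and U :: "ell1 set"
  show "dist x y = norm (x - y)" by (rule dist_ell1_def)
  show "sgn x = inverse (norm x) *\<^sub>R x" by (rule sgn_ell1_def)
  show "uniformity = (INF e\<in>{0<..}. principal {(x, y :: ell1). dist x y < e})"
    by (rule uniformity_ell1_def)
  show "open U = (\<forall>x\<in>U. eventually (\<lambda>(x', y). x' = x \<longrightarrow> y \<in> U) uniformity)"
    by (rule open_ell1_def)
  show "(norm x = 0) = (x = 0)"
    by transfer (auto simp: suminf_eq_zero_iff)
  show "norm (x + y) \<le> norm x + norm y"
  proof transfer
    fix a b :: "nat \<Rightarrow> complex"
    assume ab: "summable (\<lambda>n. cmod (a n))" "summable (\<lambda>n. cmod (b n))"
    have "(\<Sum>n. cmod (a n + b n)) \<le> (\<Sum>n. cmod (a n) + cmod (b n))"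
      by (intro suminf_le norm_triangle_ineq summable_add ab
          summable_comparison_test'[OF summable_add[OF ab]]) (auto intro: norm_triangle_ineq)
    then show "(\<Sum>n. cmod (a n + b n)) \<le> (\<Sum>n. cmod (a n)) + (\<Sum>n. cmod (b n))"
      by (simp add: suminf_add ab)
  qed
  show n: "norm (c *\<^sub>C x) = cmod c * norm x" for c and x :: ell1
    by transfer (simp add: norm_mult suminf_mult)
  show rc: "r *\<^sub>R x = complex_of_real r *\<^sub>C x" for r and x :: ell1 by transfer simp
  show "norm (r *\<^sub>R x) = \<bar>r\<bar> * norm x" by (simp add: rc n)
qed (transfer; auto simp: algebra_simps)+

end

lemma ell1_nth_minus: "ell1_nth (x - y) n = ell1_nth x n - ell1_nth y n"
  by transfer simp

lemma norm_ell1_le_iff: "norm x \<le> C \<longleftrightarrow> (\<forall>K. (\<Sum>n<K. cmod (ell1_nth x n)) \<le> C)"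
  by transfer (simp flip: ell1_iff_bound)

lemma norm_ell1_nth_le: "cmod (ell1_nth x n) \<le> norm x"
proof -
  have "cmod (ell1_nth x n) \<le> (\<Sum>k<Suc n. cmod (ell1_nth x k))"
    by (simp add: sum_nonneg)
  also have "\<dots> \<le> norm x" using norm_ell1_le_iff[of x "norm x"] by blast
  finally show ?thesis .
qed

instance ell1 :: complex_banach
proof
  fix X :: "nat \<Rightarrow> ell1" assume X: "Cauchy X"
  have "Cauchy (\<lambda>m. ell1_nth (X m) n)" for n
  proof (rule metric_CauchyI)
    fix e :: real assume "e > 0"
    then obtain M where "\<forall>i\<ge>M. \<forall>j\<ge>M. dist (X i) (X j) < e" using metric_CauchyD[OF X] by blast
    then show "\<exists>M. \<forall>i\<ge>M. \<forall>j\<ge>M. dist (ell1_nth (X i) n) (ell1_nth (X j) n) < e"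
      using norm_ell1_nth_le[of "X i - X j" n for i j]
      by (metis ell1_nth_minus dist_norm order_le_less_trans)
  qed
  then obtain l where l: "\<And>n. (\<lambda>m. ell1_nth (X m) n) \<longlonglongrightarrow> l n"
    unfolding Cauchy_convergent_iff convergent_def by metis
  have unif: "\<exists>M. \<forall>m\<ge>M. \<forall>K. (\<Sum>n<K. cmod (ell1_nth (X m) n - l n)) \<le> e" if "e > 0" for e
  proof -
    obtain M where M: "\<forall>i\<ge>M. \<forall>j\<ge>M. dist (X i) (X j) < e"
      using metric_CauchyD[OF X \<open>e > 0\<close>] by blast
    have "(\<Sum>n<K. cmod (ell1_nth (X m) n - l n)) \<le> e" if "m \<ge> M" for m K
    proof (rule tendsto_upperbound)
      show "(\<lambda>j. \<Sum>n<K. cmod (ell1_nth (X m) n - ell1_nth (X j) n))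
          \<longlonglongrightarrow> (\<Sum>n<K. cmod (ell1_nth (X m) n - l n))"
        by (intro tendsto_intros l)
      show "eventually (\<lambda>j. (\<Sum>n<K. cmod (ell1_nth (X m) n - ell1_nth (X j) n)) \<le> e) sequentially"
        using eventually_ge_at_top[of M]
      proof eventually_elim
        case (elim j)
        with M that have "norm (X m - X j) \<le> e" by (simp add: dist_norm less_imp_le)
        then show ?case unfolding norm_ell1_le_iff by (simp add: ell1_nth_minus)
      qed
    qed simp
    then show ?thesis by blast
  qed
  obtain M where "\<forall>K. (\<Sum>n<K. cmod (ell1_nth (X M) n - l n)) \<le> 1"
    using unif[of 1] by auto
  then have "summable (\<lambda>n. cmod (ell1_nth (X M) n - l n))"
    using ell1_iff_bound[of "\<lambda>n. ell1_nth (X M) n - l n" 1] by blast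
  moreover have "summable (\<lambda>n. cmod (ell1_nth (X M) n))" using ell1_nth by blast
  ultimately have "summable (\<lambda>n. cmod (ell1_nth (X M) n) + cmod (ell1_nth (X M) n - l n))"
    by (intro summable_add)
  then have "summable (\<lambda>n. cmod (l n))"
    by (rule summable_comparison_test')
      (metis norm_ge_zero abs_of_nonneg real_norm_def norm_minus_commute norm_triangle_sub)
  then obtain L where L: "l = ell1_nth L" by (metis Abs_ell1_inverse mem_Collect_eq)
  have "X \<longlonglongrightarrow> L"
  proof (rule LIMSEQ_I)
    fix e :: real assume "e > 0"
    then obtain M where "\<forall>m\<ge>M. \<forall>K. (\<Sum>n<K. cmod (ell1_nth (X m) n - l n)) \<le> e / 2"
      using unif[of "e/2"] by auto
    then have "norm (X m - L) \<le> e / 2" if "m \<ge> M" for m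
      using that unfolding norm_ell1_le_iff by (auto simp: ell1_nth_minus L)
    then show "\<exists>M. \<forall>m\<ge>M. norm (X m - L) < e"
      using \<open>e > 0\<close> by (intro exI[of _ M]) fastforce
  qed
  then show "convergent X" by (rule convergentI)
qed

instantiation ell2 :: complex_normed_vector
begin

lift_definition zero_ell2 :: ell2 is "\<lambda>_. 0" by simp
lift_definition plus_ell2 :: "ell2 \<Rightarrow> ell2 \<Rightarrow> ell2" is "\<lambda>a b n. a n + b n"
  using ell2_add by blast
lift_definition minus_ell2 :: "ell2 \<Rightarrow> ell2 \<Rightarrow> ell2" is "\<lambda>a b n. a n - b n"
  subgoal for a b using ell2_add[of a "\<lambda>n. - b n"] by simp
  done
lift_definition uminus_ell2 :: "ell2 \<Rightarrow> ell2" is "\<lambda>a n. - a n"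
  by simp
lift_definition scaleR_ell2 :: "real \<Rightarrow> ell2 \<Rightarrow> ell2" is "\<lambda>r a n. complex_of_real r * a n"
  by (simp add: norm_mult power_mult_distrib summable_mult)
lift_definition scaleC_ell2 :: "complex \<Rightarrow> ell2 \<Rightarrow> ell2" is "\<lambda>c a n. c * a n"
  by (simp add: norm_mult power_mult_distrib summable_mult)
lift_definition norm_ell2 :: "ell2 \<Rightarrow> real" is "\<lambda>a. sqrt (\<Sum>n. (cmod (a n))\<^sup>2)" .

definition dist_ell2 :: "ell2 \<Rightarrow> ell2 \<Rightarrow> real" where "dist_ell2 x y = norm (x - y)"
definition sgn_ell2 :: "ell2 \<Rightarrow> ell2" where "sgn_ell2 x = inverse (norm x) *\<^sub>R x"
definition uniformity_ell2 :: "(ell2 \<times> ell2) filter" where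
  "uniformity_ell2 = (INF e\<in>{0<..}. principal {(x, y). dist x y < e})"
definition open_ell2 :: "ell2 set \<Rightarrow> bool" where
  "open_ell2 U = (\<forall>x\<in>U. eventually (\<lambda>(x', y). x' = x \<longrightarrow> y \<in> U) uniformity)"

instance
proof
  fix x y z :: ell2 and r s :: real and c d :: complex and U :: "ell2 set"
  show "dist x y = norm (x - y)" by (rule dist_ell2_def)
  show "sgn x = inverse (norm x) *\<^sub>R x" by (rule sgn_ell2_def)
  show "uniformity = (INF e\<in>{0<..}. principal {(x, y :: ell2). dist x y < e})"
    by (rule uniformity_ell2_def)
  show "open U = (\<forall>x\<in>U. eventually (\<lambda>(x', y). x' = x \<longrightarrow> y \<in> U) uniformity)"
    by (rule open_ell2_def)
  show "(norm x = 0) = (x = 0)"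
    by transfer (auto simp: suminf_eq_zero_iff)
  show "norm (x + y) \<le> norm x + norm y"
    by transfer (use ell2_add in blast)
  show n: "norm (c *\<^sub>C x) = cmod c * norm x" for c and x :: ell2
    by transfer (simp add: norm_mult power_mult_distrib suminf_mult real_sqrt_mult)
  show rc: "r *\<^sub>R x = complex_of_real r *\<^sub>C x" for r and x :: ell2 by transfer simp
  show "norm (r *\<^sub>R x) = \<bar>r\<bar> * norm x" by (simp add: rc n)
qed (transfer; auto simp: algebra_simps)+

end

lemma ell2_nth_minus: "ell2_nth (x - y) n = ell2_nth x n - ell2_nth y n"
  by transfer simp

lemma norm_ell2_le_iff:
  "C \<ge> 0 \<Longrightarrow> norm x \<le> C \<longleftrightarrow> (\<forall>K. L2_set (\<lambda>n. cmod (ell2_nth x n)) {..<K} \<le> C)"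
  by transfer (simp flip: ell2_iff_bound)

lemma norm_ell2_nth_le: "cmod (ell2_nth x n) \<le> norm x"
proof -
  have "cmod (ell2_nth x n) \<le> L2_set (\<lambda>k. cmod (ell2_nth x k)) {..<Suc n}"
    by (rule member_le_L2_set) auto
  also have "\<dots> \<le> norm x" using norm_ell2_le_iff[of "norm x" x] by auto
  finally show ?thesis .
qed

instance ell2 :: complex_banach
proof
  fix X :: "nat \<Rightarrow> ell2" assume X: "Cauchy X"
  have "Cauchy (\<lambda>m. ell2_nth (X m) n)" for n
  proof (rule metric_CauchyI)
    fix e :: real assume "e > 0"
    then obtain M where "\<forall>i\<ge>M. \<forall>j\<ge>M. dist (X i) (X j) < e" using metric_CauchyD[OF X] by blast
    then show "\<exists>M. \<forall>i\<ge>M. \<forall>j\<ge>M. dist (ell2_nth (X i) n) (ell2_nth (X j) n) < e"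
      using norm_ell2_nth_le[of "X i - X j" n for i j]
      by (metis ell2_nth_minus dist_norm order_le_less_trans)
  qed
  then obtain l where l: "\<And>n. (\<lambda>m. ell2_nth (X m) n) \<longlonglongrightarrow> l n"
    unfolding Cauchy_convergent_iff convergent_def by metis
  have unif: "\<exists>M. \<forall>m\<ge>M. \<forall>K. L2_set (\<lambda>n. cmod (ell2_nth (X m) n - l n)) {..<K} \<le> e"
    if "e > 0" for e
  proof -
    obtain M where M: "\<forall>i\<ge>M. \<forall>j\<ge>M. dist (X i) (X j) < e"
      using metric_CauchyD[OF X \<open>e > 0\<close>] by blast
    have "L2_set (\<lambda>n. cmod (ell2_nth (X m) n - l n)) {..<K} \<le> e" if "m \<ge> M" for m K
    proof (rule tendsto_upperbound)
      show "(\<lambda>j. L2_set (\<lambda>n. cmod (ell2_nth (X m) n - ell2_nth (X j) n)) {..<K})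
          \<longlonglongrightarrow> L2_set (\<lambda>n. cmod (ell2_nth (X m) n - l n)) {..<K}"
        unfolding L2_set_def by (intro tendsto_intros l)
      show "eventually (\<lambda>j. L2_set (\<lambda>n. cmod (ell2_nth (X m) n - ell2_nth (X j) n)) {..<K} \<le> e)
          sequentially"
        using eventually_ge_at_top[of M]
      proof eventually_elim
        case (elim j)
        with M that have "norm (X m - X j) \<le> e" by (simp add: dist_norm less_imp_le)
        then show ?case
          using norm_ell2_le_iff[of e "X m - X j"] \<open>e > 0\<close> by (simp add: ell2_nth_minus)
      qed
    qed simp
    then show ?thesis by blast
  qed
  obtain M where "\<forall>K. L2_set (\<lambda>n. cmod (ell2_nth (X M) n - l n)) {..<K} \<le> 1"
    using unif[of 1] by auto
  then have "summable (\<lambda>n. (cmod (l n - ell2_nth (X M) n))\<^sup>2)"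
    using ell2_iff_bound[of 1 "\<lambda>n. ell2_nth (X M) n - l n"] by (simp add: norm_minus_commute)
  moreover have "summable (\<lambda>n. (cmod (ell2_nth (X M) n))\<^sup>2)" using ell2_nth by blast
  ultimately have "summable (\<lambda>n. (cmod (l n))\<^sup>2)"
    using ell2_add[of "\<lambda>n. l n - ell2_nth (X M) n" "ell2_nth (X M)"] by simp
  then obtain L where L: "l = ell2_nth L" by (metis Abs_ell2_inverse mem_Collect_eq)
  have "X \<longlonglongrightarrow> L"
  proof (rule LIMSEQ_I)
    fix e :: real assume "e > 0"
    then obtain M where "\<forall>m\<ge>M. \<forall>K. L2_set (\<lambda>n. cmod (ell2_nth (X m) n - l n)) {..<K} \<le> e / 2"
      using unif[of "e/2"] by auto
    then have "norm (X m - L) \<le> e / 2" if "m \<ge> M" for m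
      using that \<open>e > 0\<close> norm_ell2_le_iff[of "e / 2" "X m - L"] by (auto simp: ell2_nth_minus L)
    then show "\<exists>M. \<forall>m\<ge>M. norm (X m - L) < e"
      using \<open>e > 0\<close> by (intro exI[of _ M]) fastforce
  qed
  then show "convergent X" by (rule convergentI)
qed

text \<open>Basis vectors are indexed from \<open>0\<close>.\<close>

definition schauder_basis :: "(nat \<Rightarrow> 'a::complex_banach) \<Rightarrow> bool" where
  "schauder_basis e \<longleftrightarrow> (\<forall>x. \<exists>!a. (\<lambda>j. a j *\<^sub>C e j) sums x)"

definition normalized_basis :: "(nat \<Rightarrow> 'a::complex_banach) \<Rightarrow> bool" where
  "normalized_basis e \<longleftrightarrow> schauder_basis e \<and> (\<forall>j. norm (e j) = 1)"

definition coefficients :: "(nat \<Rightarrow> 'a::complex_banach) \<Rightarrow> 'a \<Rightarrow> nat \<Rightarrow> complex" where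
  "coefficients e x = (THE a. (\<lambda>j. a j *\<^sub>C e j) sums x)"

definition basis_projection :: "(nat \<Rightarrow> 'a::complex_banach) \<Rightarrow> nat set \<Rightarrow> 'a \<Rightarrow> 'a" where
  "basis_projection e A x = (\<Sum>j\<in>A. coefficients e x j *\<^sub>C e j)"

definition greedy_set :: "(nat \<Rightarrow> 'a::complex_banach) \<Rightarrow> 'a \<Rightarrow> nat \<Rightarrow> nat set \<Rightarrow> bool" where
  "greedy_set e x N \<Lambda> \<longleftrightarrow> finite \<Lambda> \<and> card \<Lambda> = N \<and>
    (\<forall>i\<in>\<Lambda>. \<forall>j. j \<notin> \<Lambda> \<longrightarrow> cmod (coefficients e x j) \<le> cmod (coefficients e x i))"

text \<open>The greedy sums of order \<open>N\<close> of \<open>x\<close> are the \<open>basis_projection e \<Lambda> x\<close> with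
  \<open>greedy_set e x N \<Lambda>\<close>; the sequence \<open>\<Lambda>\<close> below ranges over all ways of breaking ties.\<close>

definition quasi_greedy :: "(nat \<Rightarrow> 'a::complex_banach) \<Rightarrow> bool" where
  "quasi_greedy e \<longleftrightarrow> (\<forall>x \<Lambda>. (\<forall>N\<ge>1. greedy_set e x N (\<Lambda> N)) \<longrightarrow>
    (\<lambda>N. norm (x - basis_projection e (\<Lambda> N) x)) \<longlonglongrightarrow> 0)"

definition democratic :: "(nat \<Rightarrow> 'a::complex_banach) \<Rightarrow> bool" where
  "democratic e \<longleftrightarrow> (\<exists>D. \<forall>A B. finite A \<longrightarrow> finite B \<longrightarrow> card A = card B \<longrightarrow>
    norm (\<Sum>j\<in>A. e j) \<le> D * norm (\<Sum>j\<in>B. e j))"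

text \<open>For a normalized Schauder basis each \<open>basis_projection e A\<close> is bounded (the coefficient
  functionals are uniformly bounded by twice the basis constant), so neither the operator norm nor
  the supremum over \<open>A\<close> (with \<open>card A \<le> N\<close>) is degenerate.\<close>

definition conditionality_constant :: "(nat \<Rightarrow> 'a::complex_banach) \<Rightarrow> nat \<Rightarrow> real" where
  "conditionality_constant e N =
    (SUP A\<in>{A. finite A \<and> card A \<le> N}. onorm (basis_projection e A))"

end

theory Submission
  imports Defs
begin

text \<open>
Let \<open>x\<close> be a normalized Schauder basis of a Banach space \<open>X\<close> whose partial sum operators are
bounded by \<open>K\<close>. The basis vector \<open>x k\<close> can be spread over a block of \<open>4 ^ k\<close> vectors of
\<open>X \<oplus> \<ell>\<^sup>2\<close>, each of the form \<open>2 ^ (- k) x k\<close> plus a vector of \<open>\<ell>\<^sup>2\<close>, where the coefficients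
are the rows of an orthogonal matrix with a constant first column (a Householder reflection).
In the \<open>k\<close>-th block the coefficients \<open>c\<close> of an element \<open>f\<close> with respect to this new basis
\<open>psi\<close> are the constant \<open>2 ^ (- k) b k\<close>, where \<open>b k\<close> is the \<open>k\<close>-th \<open>x\<close>-coefficient of the
\<open>X\<close>-component of \<open>f\<close>, plus a deviation \<open>d\<close> whose sum over the block is \<open>0\<close>. Moreover
\<open>cmod (b k) \<le> 2 * K * norm f\<close> and the \<open>\<ell>\<^sup>2\<close>-norm of \<open>d\<close> is at most \<open>norm f\<close>, and
conversely a sum of \<open>c j\<close> times \<open>psi j\<close> over a finite set \<open>A\<close> is at most the \<open>\<ell>\<^sup>2\<close>-norm of \<open>c\<close>
on \<open>A\<close> plus the sum over \<open>k\<close> of \<open>2 ^ (- k)\<close> times the modulus of the sum of \<open>c\<close> over the part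
of \<open>A\<close> in block \<open>k\<close>. These facts give all three properties.

Quasi-greediness (\<open>norm_greedy_sum_le\<close>): let \<open>t\<close> be the smallest modulus of a selected
coefficient. In the first blocks, where the constant part may exceed \<open>t / 2\<close>, the greedy sum
differs from a partial sum only by coefficients of modulus at most \<open>t\<close>, and these are
controlled by a geometric series. In the later blocks the constant part is too small to be
selected by itself, so the modulus of a selected coefficient is at most \<open>2\<close> times that of its
deviation and at most \<open>4 / t\<close> times the square of the latter. A uniform bound on greedy sums
gives their convergence (\<open>quasi_greedyI\<close>).

Democracy (\<open>norm_sum_psi_le\<close>, \<open>sqrt_card_le_norm_sum_psi\<close>): a sum of \<open>N\<close> basis vectors has
norm comparable to \<open>sqrt N\<close>. For the lower bound, \<open>N\<close> is the squared \<open>\<ell>\<^sup>2\<close>-norm of the deviation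
plus the sum of the squares of the \<open>b k\<close>; blocks that are less than half full contribute at most
\<open>N / 2\<close> to the latter, and the others are dominated geometrically by the largest \<open>b k\<close>.

Conditionality: a set with at most \<open>4 ^ m\<close> elements can fill a substantial part of only about \<open>m\<close>
blocks, and each contributes at most a multiple of \<open>norm f\<close> to a projection
(\<open>norm_projection_le\<close>), so the conditionality constants are \<open>O(ln N)\<close>. On the other hand,
projecting onto whole blocks is the same as projecting onto the corresponding \<open>x k\<close> in \<open>X\<close>; hence
if \<open>X\<close> has projections of norm at least \<open>c * n\<close> onto subsets of its first \<open>n\<close> basis vectors, the
constants of \<open>psi\<close> are also at least a multiple of \<open>ln N\<close> (\<open>le_conditionality_psi\<close>).

Finally \<open>c\<^sub>0 \<oplus> \<ell>\<^sup>1\<close> has such a basis: the summing basis of \<open>c\<^sub>0\<close> interleaved with the unit vectors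
of \<open>\<ell>\<^sup>1\<close>. Alternating sums of the summing basis have norm \<open>1\<close>, whereas the sum of the \<open>n\<close> terms
of one sign has norm \<open>n\<close> (\<open>interleaved_conditional\<close>).
\<close>

section \<open>Complex scalars and expansions in a Schauder basis\<close>

lemma scaleC_zero_left [simp]: "0 *\<^sub>C (x::'a::complex_normed_vector) = 0"
  using scaleC_add_left[of 0 0 x] by simp

lemma scaleC_zero_right [simp]: "c *\<^sub>C (0::'a::complex_normed_vector) = 0"
  using scaleC_add_right[of c 0 "0::'a"] by simp

lemma scaleC_one [simp]: "1 *\<^sub>C (x::'a::complex_normed_vector) = x"
  using scaleR_scaleC[of 1 x] by simp

lemma scaleC_minus_left: "(- c) *\<^sub>C (x::'a::complex_normed_vector) = - (c *\<^sub>C x)"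
  using scaleC_add_left[of c "- c" x] by (simp add: eq_neg_iff_add_eq_0 add.commute)

lemma scaleC_diff_left: "(c - d) *\<^sub>C (x::'a::complex_normed_vector) = c *\<^sub>C x - d *\<^sub>C x"
  using scaleC_add_left[of c "- d" x] by (simp add: scaleC_minus_left)

lemma scaleC_sum_left: "(\<Sum>i\<in>A. c i) *\<^sub>C (x::'a::complex_normed_vector) = (\<Sum>i\<in>A. c i *\<^sub>C x)"
  by (induction A rule: infinite_finite_induct) (auto simp: scaleC_add_left)

lemma fst_scaleC [simp]: "fst (c *\<^sub>C p) = c *\<^sub>C fst p"
  and snd_scaleC [simp]: "snd (c *\<^sub>C p) = c *\<^sub>C snd p"
  by (simp_all add: scaleC_prod_def)

lemma coefficients_eqI:
  assumes "schauder_basis e" "(\<lambda>j. a j *\<^sub>C e j) sums x"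
  shows "coefficients e x = a"
  unfolding coefficients_def
  by (rule the1_equality) (use assms in \<open>auto simp: schauder_basis_def\<close>)

lemma coefficients_sums:
  assumes "schauder_basis e"
  shows "(\<lambda>j. coefficients e x j *\<^sub>C e j) sums x"
  unfolding coefficients_def
  by (rule theI'[where P = "\<lambda>a. (\<lambda>j. a j *\<^sub>C e j) sums x"])
    (use assms in \<open>auto simp: schauder_basis_def\<close>)

lemma coefficients_diff:
  assumes "schauder_basis e"
  shows "coefficients e (x - y) = (\<lambda>j. coefficients e x j - coefficients e y j)"
  by (rule coefficients_eqI[OF assms])
    (simp add: scaleC_diff_left sums_diff coefficients_sums[OF assms])

lemma coefficients_finite_sum:
  assumes "schauder_basis e" "finite A"
  shows "coefficients e (\<Sum>j\<in>A. a j *\<^sub>C e j) = (\<lambda>j. if j \<in> A then a j else 0)"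
proof (rule coefficients_eqI[OF assms(1)])
  have "(\<lambda>j. if j \<in> A then a j *\<^sub>C e j else 0) sums (\<Sum>j\<in>A. a j *\<^sub>C e j)"
    by (rule sums_If_finite_set[OF assms(2)])
  then show "(\<lambda>j. (if j \<in> A then a j else 0) *\<^sub>C e j) sums (\<Sum>j\<in>A. a j *\<^sub>C e j)"
    by (simp add: if_distrib[of "\<lambda>c. c *\<^sub>C e j" for j] cong: if_cong)
qed

lemma coefficients_tendsto_0:
  assumes "normalized_basis e"
  shows "coefficients e x \<longlonglongrightarrow> 0"
proof -
  have "(\<lambda>j. coefficients e x j *\<^sub>C e j) \<longlonglongrightarrow> 0"
    using assms coefficients_sums sums_summable summable_LIMSEQ_zero
    unfolding normalized_basis_def by blast
  then have "(\<lambda>j. norm (coefficients e x j *\<^sub>C e j)) \<longlonglongrightarrow> 0"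
    by (rule tendsto_norm_zero)
  then show ?thesis
    using assms by (simp add: normalized_basis_def norm_scaleC tendsto_norm_zero_iff)
qed

text \<open>A partial sum \<open>y\<close> of \<open>x\<close> approximates it, and for large \<open>N\<close> every greedy set contains the
support of \<open>y\<close>. The rest of the greedy set is then a greedy set of the small remainder
\<open>x - y\<close>, whose greedy sums are small by the uniform bound.\<close>

lemma quasi_greedyI:
  assumes e: "normalized_basis e"
    and bound: "\<And>x N \<Lambda>. greedy_set e x N \<Lambda> \<Longrightarrow> norm (basis_projection e \<Lambda> x) \<le> C * norm x"
  shows "quasi_greedy e"
  unfolding quasi_greedy_def
proof (intro allI impI)
  fix x \<Lambda> assume gs: "\<forall>N\<ge>1. greedy_set e x N (\<Lambda> N)"
  have sb: "schauder_basis e" using e by (simp add: normalized_basis_def)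
  define a where "a = coefficients e x"
  have "C \<ge> 0"
  proof -
    have "norm (basis_projection e {} (e 0)) \<le> C * norm (e 0)"
      by (rule bound[of _ 0]) (simp add: greedy_set_def)
    then show ?thesis using e by (simp add: basis_projection_def normalized_basis_def)
  qed
  show "(\<lambda>N. norm (x - basis_projection e (\<Lambda> N) x)) \<longlonglongrightarrow> 0"
  proof (rule LIMSEQ_I)
    fix \<epsilon> :: real assume "\<epsilon> > 0"
    define \<delta> where "\<delta> = \<epsilon> / (1 + C)"
    have "\<delta> > 0" using \<open>\<epsilon> > 0\<close> \<open>C \<ge> 0\<close> by (simp add: \<delta>_def)
    have "(\<lambda>n. \<Sum>j<n. a j *\<^sub>C e j) \<longlonglongrightarrow> x"
      using coefficients_sums[OF sb, of x] unfolding sums_def a_def .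
    from LIMSEQ_D[OF this \<open>\<delta> > 0\<close>]
    obtain m where m: "norm ((\<Sum>j<m. a j *\<^sub>C e j) - x) < \<delta>" by blast
    define y where "y = (\<Sum>j<m. a j *\<^sub>C e j)"
    define r where "r = x - y"
    have r: "norm r < \<delta>" using m by (simp add: r_def y_def norm_minus_commute)
    have ra: "coefficients e r = (\<lambda>j. if j < m then 0 else a j)"
      unfolding r_def coefficients_diff[OF sb] y_def coefficients_finite_sum[OF sb finite_lessThan]
      by (auto simp: a_def)
    define F where "F = {j. j < m \<and> a j \<noteq> 0}"
    have "finite F" by (simp add: F_def)
    obtain t where t: "t > 0" "\<And>j. j \<in> F \<Longrightarrow> t \<le> cmod (a j)"
    proof (cases "F = {}")
      case True then show ?thesis using that[of 1] by simp
    next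
      case False
      have "Min ((\<lambda>j. cmod (a j)) ` F) \<in> (\<lambda>j. cmod (a j)) ` F"
        using \<open>finite F\<close> False by (intro Min_in) auto
      then have "Min ((\<lambda>j. cmod (a j)) ` F) > 0" by (auto simp: F_def)
      then show ?thesis using that \<open>finite F\<close> by (auto intro: Min_le)
    qed
    have fin: "finite {j. t \<le> cmod (a j)}"
    proof -
      have "\<forall>\<^sub>F j in sequentially. cmod (a j) < t"
        using tendstoD[OF coefficients_tendsto_0[OF e] t(1), of x] by (simp add: a_def)
      then show ?thesis
        unfolding eventually_sequentially
        by (metis (no_types, lifting) finite_nat_set_iff_bounded mem_Collect_eq not_le)
    qed
    show "\<exists>no. \<forall>N\<ge>no. norm (norm (x - basis_projection e (\<Lambda> N) x) - 0) < \<epsilon>"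
    proof (intro exI allI impI)
      fix N assume N: "Suc (card {j. t \<le> cmod (a j)}) \<le> N"
      let ?L = "\<Lambda> N"
      have "greedy_set e x N ?L" using gs N by simp
      then have g: "finite ?L" "card ?L = N"
        "\<And>i j. i \<in> ?L \<Longrightarrow> j \<notin> ?L \<Longrightarrow> cmod (a j) \<le> cmod (a i)"
        unfolding greedy_set_def a_def by auto
      have "F \<subseteq> ?L"
      proof
        fix j assume "j \<in> F"
        show "j \<in> ?L"
        proof (rule ccontr)
          assume "j \<notin> ?L"
          then have "?L \<subseteq> {j. t \<le> cmod (a j)}"
            using g(3) t(2)[OF \<open>j \<in> F\<close>] by fastforce
          then have "card ?L \<le> card {j. t \<le> cmod (a j)}" by (rule card_mono[OF fin])
          then show False using g N by simp
        qed
      qed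
      let ?L' = "?L - {..<m}"
      have "greedy_set e r (card ?L') ?L'"
        using g unfolding greedy_set_def ra by auto
      then have b: "norm (basis_projection e ?L' r) \<le> C * norm r" by (rule bound)
      have "basis_projection e ?L x = (\<Sum>j\<in>?L \<inter> {..<m}. a j *\<^sub>C e j) + (\<Sum>j\<in>?L'. a j *\<^sub>C e j)"
        unfolding basis_projection_def a_def[symmetric] by (rule sum.Int_Diff[OF g(1)])
      also have "(\<Sum>j\<in>?L'. a j *\<^sub>C e j) = basis_projection e ?L' r"
        unfolding basis_projection_def ra by (intro sum.cong) auto
      also have "(\<Sum>j\<in>?L \<inter> {..<m}. a j *\<^sub>C e j) = y"
        unfolding y_def using \<open>F \<subseteq> ?L\<close> by (intro sum.mono_neutral_left) (auto simp: F_def)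
      finally have "x - basis_projection e ?L x = r - basis_projection e ?L' r"
        by (simp add: r_def)
      then have "norm (x - basis_projection e ?L x) \<le> norm r + C * norm r"
        using norm_triangle_ineq4[of r "basis_projection e ?L' r"] b by simp
      also have "\<dots> = (1 + C) * norm r" by (simp add: algebra_simps)
      also have "\<dots> < (1 + C) * \<delta>" using r \<open>C \<ge> 0\<close> by (intro mult_strict_left_mono) auto
      also have "\<dots> = \<epsilon>" using \<open>C \<ge> 0\<close> by (simp add: \<delta>_def)
      finally show "norm (norm (x - basis_projection e ?L x) - 0) < \<epsilon>" by simp
    qed
  qed
qed

lemma conditionality_constant_le:
  assumes "\<And>A x. finite A \<Longrightarrow> card A \<le> N \<Longrightarrow> norm (basis_projection e A x) \<le> C * norm x" "C \<ge> 0"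
  shows "conditionality_constant e N \<le> C"
  unfolding conditionality_constant_def
  by (rule cSUP_least) (use assms in \<open>auto intro!: onorm_bound exI[of _ "{}"]\<close>)

text \<open>The uniform bound \<open>C\<close> is there to make the two suprema, over vectors and over sets, finite.\<close>

lemma le_conditionality_constant:
  assumes bound: "\<And>A x. finite A \<Longrightarrow> card A \<le> N \<Longrightarrow> norm (basis_projection e A x) \<le> C * norm x"
    and "C \<ge> 0"
    and A: "finite A" "card A \<le> N"
    and x: "x \<noteq> 0" "r * norm x \<le> norm (basis_projection e A x)"
  shows "r \<le> conditionality_constant e N"
proof -
  have "r \<le> norm (basis_projection e A x) / norm x" using x by (simp add: field_simps)
  also have "\<dots> \<le> onorm (basis_projection e A)"
    unfolding onorm_def
  proof (rule cSUP_upper)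
    show "bdd_above (range (\<lambda>x. norm (basis_projection e A x) / norm x))"
      using bound[OF A] \<open>C \<ge> 0\<close>
      by (intro bdd_aboveI[of _ C]) (auto simp: divide_le_eq)
  qed simp
  also have "\<dots> \<le> conditionality_constant e N"
    unfolding conditionality_constant_def
  proof (rule cSUP_upper)
    show "bdd_above ((\<lambda>A. onorm (basis_projection e A)) ` {A. finite A \<and> card A \<le> N})"
      using bound \<open>C \<ge> 0\<close> by (intro bdd_aboveI[of _ C]) (auto intro!: onorm_bound)
  qed (use A in auto)
  finally show ?thesis .
qed

section \<open>Invariance under isometric isomorphisms\<close>

text \<open>The product type nests its norms, so the two ways to bracket a threefold sum are different types.
All notions around bases are transported along a linear isometry between them.\<close>

locale isometric_isomorphism =
  fixes J :: "'a::complex_banach \<Rightarrow> 'b::complex_banach"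
  assumes J_add: "J (f + g) = J f + J g"
    and J_scaleC: "J (c *\<^sub>C f) = c *\<^sub>C J f"
    and norm_J: "norm (J f) = norm f"
    and surj_J: "surj J"
begin

lemma J_diff: "J (f - g) = J f - J g"
  using J_add[of "f - g" g] by simp

lemma J_sum: "J (\<Sum>i\<in>A. h i) = (\<Sum>i\<in>A. J (h i))"
  using J_diff[of 0 0] by (induction A rule: infinite_finite_induct) (auto simp: J_add)

lemma sums_J_iff: "(\<lambda>j. a j *\<^sub>C J (e j)) sums J f \<longleftrightarrow> (\<lambda>j. a j *\<^sub>C e j) sums f"
proof -
  have "(\<Sum>j<n. a j *\<^sub>C J (e j)) - J f = J ((\<Sum>j<n. a j *\<^sub>C e j) - f)" for n
    by (simp add: J_diff J_sum J_scaleC)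
  then have "norm ((\<Sum>j<n. a j *\<^sub>C J (e j)) - J f) = norm ((\<Sum>j<n. a j *\<^sub>C e j) - f)" for n
    by (simp add: norm_J)
  then show ?thesis unfolding sums_def tendsto_iff dist_norm by simp
qed

lemma coefficients_J: "coefficients (\<lambda>j. J (e j)) (J f) = coefficients e f"
  by (simp add: coefficients_def sums_J_iff)

lemma basis_projection_J: "basis_projection (\<lambda>j. J (e j)) A (J f) = J (basis_projection e A f)"
  by (simp add: basis_projection_def coefficients_J J_sum J_scaleC)

lemma normalized_basis_J:
  assumes "normalized_basis e"
  shows "normalized_basis (\<lambda>j. J (e j))"
  unfolding normalized_basis_def schauder_basis_def
proof (intro conjI allI)
  fix g
  obtain f where "g = J f" using surj_J by blast
  then show "\<exists>!a. (\<lambda>j. a j *\<^sub>C J (e j)) sums g"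
    using assms by (simp add: sums_J_iff normalized_basis_def schauder_basis_def)
qed (use assms in \<open>simp add: norm_J normalized_basis_def\<close>)

lemma quasi_greedy_J:
  assumes "quasi_greedy e"
  shows "quasi_greedy (\<lambda>j. J (e j))"
  unfolding quasi_greedy_def
proof (intro allI impI)
  fix g \<Lambda> assume gs: "\<forall>N\<ge>1. greedy_set (\<lambda>j. J (e j)) g N (\<Lambda> N)"
  obtain f where f: "g = J f" using surj_J by blast
  have "\<forall>N\<ge>1. greedy_set e f N (\<Lambda> N)" using gs by (simp add: greedy_set_def f coefficients_J)
  then have "(\<lambda>N. norm (f - basis_projection e (\<Lambda> N) f)) \<longlonglongrightarrow> 0"
    using assms by (simp add: quasi_greedy_def)
  then show "(\<lambda>N. norm (g - basis_projection (\<lambda>j. J (e j)) (\<Lambda> N) g)) \<longlonglongrightarrow> 0"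
    by (simp add: f basis_projection_J norm_J flip: J_diff)
qed

lemma democratic_J: "democratic e \<Longrightarrow> democratic (\<lambda>j. J (e j))"
  by (simp add: democratic_def norm_J flip: J_sum)

lemma conditionality_constant_J:
  "conditionality_constant (\<lambda>j. J (e j)) N = conditionality_constant e N"
proof -
  have "onorm (basis_projection (\<lambda>j. J (e j)) A) = onorm (basis_projection e A)" for A
  proof -
    have "range (\<lambda>g. norm (basis_projection (\<lambda>j. J (e j)) A g) / norm g)
        = (\<lambda>g. norm (basis_projection (\<lambda>j. J (e j)) A g) / norm g) ` range J"
      using surj_J by simp
    also have "\<dots> = range (\<lambda>f. norm (basis_projection e A f) / norm f)"
      by (simp add: image_image basis_projection_J norm_J)
    finally show ?thesis by (simp add: onorm_def)
  qed
  then show ?thesis by (simp add: conditionality_constant_def)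
qed

end

section \<open>Blocks of exponentially growing length\<close>

text \<open>The natural numbers are cut into consecutive blocks, the \<open>k\<close>-th one having \<open>4 ^ k\<close> elements. The
length is a power of \<open>4\<close> so that its square root, by which sums over a block are normalized, is
the integer power \<open>2 ^ k\<close>.\<close>

definition block_start :: "nat \<Rightarrow> nat" where
  "block_start k = (\<Sum>i<k. 4 ^ i)"

definition level :: "nat \<Rightarrow> nat" where
  "level j = (LEAST k. j < block_start (Suc k))"

definition block :: "nat \<Rightarrow> nat set" where
  "block k = {j. level j = k}"

lemma block_start_Suc: "block_start (Suc k) = block_start k + 4 ^ k"
  by (simp add: block_start_def)

lemma strict_mono_block_start: "strict_mono block_start"
  by (simp add: strict_mono_Suc_iff block_start_Suc)

lemma level_eq_iff: "level j = k \<longleftrightarrow> block_start k \<le> j \<and> j < block_start (Suc k)"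
proof -
  have "j < block_start (Suc j)"
    using strict_mono_imp_increasing[OF strict_mono_block_start, of j] 
    by (simp add: block_start_Suc le_less_trans)
  then have upper: "j < block_start (Suc (level j))"
    unfolding level_def by (rule LeastI[where P = "\<lambda>k. j < block_start (Suc k)"])
  have lower: "block_start (level j) \<le> j"
  proof (cases "level j")
    case 0 then show ?thesis by (simp add: block_start_def)
  next
    case (Suc k)
    then have "k < (LEAST k. j < block_start (Suc k))" unfolding level_def by simp
    then have "\<not> j < block_start (Suc k)" by (rule not_less_Least)
    then show ?thesis using Suc by simp
  qed
  show ?thesis
  proof
    assume "block_start k \<le> j \<and> j < block_start (Suc k)"
    then have "block_start k < block_start (Suc (level j))"
      and "block_start (level j) < block_start (Suc k)" using upper lower by linarith+
    then show "level j = k" by (simp add: strict_mono_less[OF strict_mono_block_start])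
  qed (use upper lower in auto)
qed

lemma level_block_start [simp]: "level (block_start k) = k"
  by (simp add: level_eq_iff block_start_Suc)

lemma mem_block [simp]: "j \<in> block k \<longleftrightarrow> level j = k"
  by (simp add: block_def)

lemma block_eq: "block k = {block_start k..<block_start (Suc k)}"
  by (auto simp: level_eq_iff)

lemma finite_block [simp]: "finite (block k)"
  by (simp add: block_eq)

lemma card_block: "card (block k) = 4 ^ k"
  by (simp add: block_eq block_start_Suc)

lemma level_less_iff: "level j < m \<longleftrightarrow> j < block_start m"
proof -
  have "level j < m \<longleftrightarrow> block_start (Suc (level j)) \<le> block_start m"
    by (simp add: strict_mono_less_eq[OF strict_mono_block_start] Suc_le_eq)
  then show ?thesis using level_eq_iff[of j "level j"]
    by (metis less_le_trans linorder_not_le not_less_eq_eq order_less_imp_le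
        strict_mono_block_start strict_mono_less_eq order_le_less_trans)
qed

lemma sum_over_levels:
  assumes "finite A" "finite T" "level ` A \<subseteq> T"
  shows "(\<Sum>k\<in>T. \<Sum>j\<in>A \<inter> block k. h j) = sum h A"
proof -
  have "A \<inter> block k = {j \<in> A. level j = k}" for k by auto
  then show ?thesis using sum.group[OF assms, of h] by simp
qed

lemma sum_over_first_blocks:
  "(\<Sum>j<block_start m. h j) = (\<Sum>k<m. \<Sum>j\<in>block k. h j)"
proof -
  have "{..<block_start m} \<inter> block k = block k" if "k < m" for k
    using that by (auto simp flip: level_less_iff)
  then have "(\<Sum>k<m. \<Sum>j\<in>block k. h j) = (\<Sum>k<m. \<Sum>j\<in>{..<block_start m} \<inter> block k. h j)"
    by (intro sum.cong) auto
  also have "\<dots> = (\<Sum>j<block_start m. h j)"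
    by (rule sum_over_levels) (auto simp: level_less_iff)
  finally show ?thesis by simp
qed

lemma power4_eq: "(4 :: 'a :: comm_semiring_1) ^ k = 2 ^ k * 2 ^ k"
proof -
  have "(4 :: 'a) = 2 * 2" by simp
  then show ?thesis by (simp only: power_mult_distrib)
qed

lemma sum_powers_of_2_le:
  assumes "finite F" "a \<ge> 0" "\<And>k. k \<in> F \<Longrightarrow> 2 ^ k \<le> a"
  shows "(\<Sum>k\<in>F. 2 ^ k :: real) \<le> 2 * a"
proof (cases "F = {}")
  case False
  have le: "(\<Sum>k\<le>M. 2 ^ k :: real) \<le> 2 * 2 ^ M" for M
    by (induction M) auto
  have "(\<Sum>k\<in>F. 2 ^ k :: real) \<le> (\<Sum>k\<le>Max F. 2 ^ k)"
    using assms(1) by (intro sum_mono2) auto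
  also have "\<dots> \<le> 2 * 2 ^ Max F" by (rule le)
  also have "\<dots> \<le> 2 * a" using assms False by simp
  finally show ?thesis .
qed (use assms in simp)

lemma sum_norm_le_sqrt_card:
  "(\<Sum>j\<in>A. cmod (c j)) \<le> sqrt (card A) * sqrt (\<Sum>j\<in>A. (cmod (c j))\<^sup>2)"
  using L2_set_mult_ineq[of "\<lambda>_. 1" "\<lambda>j. cmod (c j)" A] by (simp add: L2_set_def)

lemma power4_bracket:
  assumes "N \<ge> (1 :: nat)"
  obtains m where "N \<le> 4 ^ m" "m = 0 \<or> 4 ^ (m - 1) < N"
proof
  have "N < 4 ^ N" by (rule less_exp[THEN order_less_le_trans]) (simp add: power_mono)
  then have ex: "N \<le> 4 ^ N" by simp
  show "N \<le> 4 ^ (LEAST m. N \<le> 4 ^ m)"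
    by (rule LeastI[of "\<lambda>m. N \<le> 4 ^ m", OF ex])
  show "(LEAST m. N \<le> 4 ^ m) = 0 \<or> 4 ^ ((LEAST m. N \<le> 4 ^ m) - 1) < N"
    using not_less_Least[of "(LEAST m. N \<le> 4 ^ m) - 1" "\<lambda>m. N \<le> 4 ^ m"] by linarith
qed

text \<open>Used with a set of at most \<open>4 ^ m\<close> indices: \<open>u\<close> bounds the contribution of the blocks that the set
may fill, while the bound \<open>w\<close> for the longer blocks carries a factor \<open>2 ^ (- m)\<close> or \<open>4 ^ (- m)\<close> that
makes up for the number of elements of the set.\<close>

lemma sum_split_le:
  fixes r u w :: "nat \<Rightarrow> real"
  assumes "finite T"
    and "\<And>k. k \<in> T \<Longrightarrow> k < m \<Longrightarrow> r k \<le> u k" "\<And>k. k \<in> T \<Longrightarrow> m \<le> k \<Longrightarrow> r k \<le> w k"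
    and "\<And>k. 0 \<le> u k" "\<And>k. 0 \<le> w k"
  shows "(\<Sum>k\<in>T. r k) \<le> (\<Sum>k<m. u k) + (\<Sum>k\<in>T. w k)"
proof -
  have "(\<Sum>k\<in>T. r k) \<le> (\<Sum>k\<in>T. (if k \<in> {..<m} then u k else 0) + w k)"
  proof (rule sum_mono)
    fix k assume "k \<in> T"
    then show "r k \<le> (if k \<in> {..<m} then u k else 0) + w k"
      using assms(2)[of k] assms(3)[of k] assms(5)[of k] by (cases "k < m") auto
  qed
  also have "\<dots> = (\<Sum>k\<in>T \<inter> {..<m}. u k) + (\<Sum>k\<in>T. w k)"
    using assms(1) by (simp add: sum.distrib sum.inter_restrict)
  also have "(\<Sum>k\<in>T \<inter> {..<m}. u k) \<le> (\<Sum>k<m. u k)"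
    using assms(4) by (intro sum_mono2) auto
  finally show ?thesis by simp
qed

lemma finite_first_blocks:
  assumes "finite A"
  obtains m where "A \<subseteq> {..<block_start m}"
proof -
  obtain M where "A \<subseteq> {..<M}" using assms finite_nat_iff_bounded by blast
  moreover have "M \<le> block_start M" by (rule strict_mono_imp_increasing[OF strict_mono_block_start])
  ultimately have "A \<subseteq> {..<block_start M}" by auto
  then show ?thesis by (rule that)
qed

lemma sum_card_levels:
  assumes "finite A"
  shows "(\<Sum>k\<in>level ` A. real (card (A \<inter> block k))) = card A"
  using sum_over_levels[OF assms _ order_refl, of "\<lambda>_. 1 :: real"] assms by simp

lemma card_inter_block_le: "real (card (A \<inter> block k)) \<le> 4 ^ k"
proof -
  have "card (A \<inter> block k) \<le> 4 ^ k"
    unfolding card_block[symmetric] by (intro card_mono) auto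
  from of_nat_mono[OF this, where 'a = real] show ?thesis by simp
qed

section \<open>Householder reflections of the blocks\<close>

text \<open>The component of a block along the unit vector with all entries \<open>2 ^ (- k)\<close>.\<close>

definition balance :: "(nat \<Rightarrow> complex) \<Rightarrow> nat \<Rightarrow> complex" where
  "balance v k = (\<Sum>i\<in>block k. v i) / 2 ^ k"

text \<open>On each block this is the Householder reflection that exchanges the first coordinate vector with
the constant unit vector: with \<open>w\<close> the difference of the two, it is
\<open>v - 2 * inner v w / inner w w * w\<close>. At the first index of the block this gives the balance.
Block \<open>0\<close>, where the denominator vanishes, has no other index.\<close>

definition reflect :: "(nat \<Rightarrow> complex) \<Rightarrow> nat \<Rightarrow> complex" where
  "reflect v j = (if j = block_start (level j) then balance v (level j)
     else v j + (v (block_start (level j)) - balance v (level j)) / (2 ^ level j - 1))"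

lemma balance_sum: "balance (\<lambda>i. \<Sum>a\<in>A. f a i) k = (\<Sum>a\<in>A. balance (f a) k)"
  unfolding balance_def by (subst sum.swap) (simp add: sum_divide_distrib)

lemma balance_scale: "balance (\<lambda>i. c * v i) k = c * balance v k"
  by (simp add: balance_def sum_distrib_left)

lemma reflect_sum: "reflect (\<lambda>i. \<Sum>a\<in>A. f a i) j = (\<Sum>a\<in>A. reflect (f a) j)"
  by (simp add: reflect_def balance_sum sum.distrib flip: sum_divide_distrib sum_subtractf)

lemma reflect_scale: "reflect (\<lambda>i. c * v i) j = c * reflect v j"
  by (simp add: reflect_def balance_scale ring_distribs flip: right_diff_distrib times_divide_eq_right)

lemma reflect_cong:
  assumes "\<And>i. level i = level j \<Longrightarrow> v i = w i"
  shows "reflect v j = reflect w j"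
proof -
  have "balance v (level j) = balance w (level j)"
    unfolding balance_def using assms by (intro arg_cong2[of _ _ _ _ "(/)"] sum.cong) auto
  then show ?thesis using assms by (simp add: reflect_def)
qed

text \<open>Off the first index, the reflection adds the constant \<open>\<alpha>\<close>. Expressed by \<open>\<alpha>\<close> and the balance, the
first entry and the sum of the other entries are polynomial in \<open>2 ^ k\<close>, so that everything below
becomes a ring identity. In block \<open>0\<close> the equations hold with \<open>\<alpha> = 0 / 0 = 0\<close>.\<close>

lemma reflect_on_block:
  fixes v k
  defines "\<alpha> \<equiv> (v (block_start k) - balance v k) / (2 ^ k - 1)"
  shows "v (block_start k) = balance v k + (2 ^ k - 1) * \<alpha>"
    and "(\<Sum>i\<in>block k - {block_start k}. v i) = (2 ^ k - 1) * (balance v k - \<alpha>)"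
    and "reflect v (block_start k) = balance v k"
    and "\<And>j. j \<in> block k - {block_start k} \<Longrightarrow> reflect v j = v j + \<alpha>"
proof -
  show q: "v (block_start k) = balance v k + (2 ^ k - 1) * \<alpha>"
  proof (cases "k = 0")
    case True
    have "block 0 = {0}" unfolding block_eq by (auto simp: block_start_def)
    then show ?thesis using True by (simp add: balance_def block_start_def)
  next
    case False
    then have "1 < (2 :: real) ^ k" by simp
    then have "(2 :: real) ^ k \<noteq> 1" by linarith
    then have "(2 :: complex) ^ k \<noteq> 1"
      by (metis of_real_eq_1_iff of_real_numeral of_real_power)
    then show ?thesis by (simp add: \<alpha>_def)
  qed
  have "(\<Sum>i\<in>block k. v i) = 2 ^ k * balance v k" by (simp add: balance_def)
  then have "(\<Sum>i\<in>block k - {block_start k}. v i) = 2 ^ k * balance v k - v (block_start k)"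
    by (simp add: sum_diff1)
  then show "(\<Sum>i\<in>block k - {block_start k}. v i) = (2 ^ k - 1) * (balance v k - \<alpha>)"
    by (simp add: q algebra_simps)
qed (auto simp: reflect_def \<alpha>_def)

lemma card_block_tail: "of_nat (card (block k - {block_start k})) = (2 ^ k - 1) * (2 ^ k + 1 :: complex)"
  by (simp add: card_block of_nat_diff power4_eq algebra_simps)

lemma sum_block_split: "(\<Sum>j\<in>block k. h j) = h (block_start k) + (\<Sum>j\<in>block k - {block_start k}. h j)"
  by (rule sum.remove) auto

lemma balance_reflect: "balance (reflect v) k = v (block_start k)"
proof -
  define \<alpha> where "\<alpha> = (v (block_start k) - balance v k) / (2 ^ k - 1)"
  note R = reflect_on_block[where v = v and k = k, folded \<alpha>_def]
  have "(\<Sum>j\<in>block k. reflect v j)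
      = balance v k + ((\<Sum>j\<in>block k - {block_start k}. v j)
          + of_nat (card (block k - {block_start k})) * \<alpha>)"
    unfolding sum_block_split[of _ k] by (simp add: R(3,4) sum.distrib del: Diff_iff)
  also have "\<dots> = 2 ^ k * v (block_start k)"
    unfolding card_block_tail R(2) by (subst R(1)) (simp add: algebra_simps)
  finally show ?thesis by (simp add: balance_def)
qed

lemma reflect_reflect [simp]: "reflect (reflect v) = v"
proof
  fix j
  show "reflect (reflect v) j = v j"
  proof (cases "j = block_start (level j)")
    case True
    then show ?thesis by (simp add: reflect_def[of "reflect v"] balance_reflect)
  next
    case False
    have "reflect (reflect v) j
        = reflect v j + (balance v (level j) - v (block_start (level j))) / (2 ^ level j - 1)"
      using False by (simp add: reflect_def[of "reflect v"] balance_reflect reflect_on_block(3))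
    also have "\<dots> = v j"
      using False by (simp add: reflect_def[of v] flip: add_divide_distrib)
    finally show ?thesis .
  qed
qed

text \<open>Orthogonality of the reflection; expanding the squares uses only the sum of the entries and the
number of entries off the first index.\<close>

lemma sum_norm_squared_reflect:
  "(\<Sum>j\<in>block k. (cmod (reflect v j))\<^sup>2) = (\<Sum>j\<in>block k. (cmod (v j))\<^sup>2)"
proof -
  define \<alpha> where "\<alpha> = (v (block_start k) - balance v k) / (2 ^ k - 1)"
  define \<beta> where "\<beta> = balance v k"
  define T where "T = block k - {block_start k}"
  note R = reflect_on_block[where v = v and k = k, folded \<alpha>_def \<beta>_def T_def]
  have cT: "(\<Sum>j\<in>T. cnj (v j)) = (2 ^ k - 1) * (cnj \<beta> - cnj \<alpha>)"
    using arg_cong[OF R(2), of cnj] by simp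
  have "(\<Sum>j\<in>block k. reflect v j * cnj (reflect v j))
      = \<beta> * cnj \<beta> + (\<Sum>j\<in>T. (v j + \<alpha>) * cnj (v j + \<alpha>))"
    unfolding sum_block_split[of _ k] T_def[symmetric] using R(3,4) by simp
  also have "(\<Sum>j\<in>T. (v j + \<alpha>) * cnj (v j + \<alpha>)) = (\<Sum>j\<in>T. v j * cnj (v j))
      + (\<Sum>j\<in>T. v j) * cnj \<alpha> + \<alpha> * (\<Sum>j\<in>T. cnj (v j)) + of_nat (card T) * (\<alpha> * cnj \<alpha>)"
    by (simp add: ring_distribs sum.distrib sum_distrib_left sum_distrib_right)
  also have "\<beta> * cnj \<beta> + \<dots> = (\<Sum>j\<in>T. v j * cnj (v j)) + v (block_start k) * cnj (v (block_start k))"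
    unfolding R(1,2) cT card_block_tail[of k, folded T_def] by (simp add: algebra_simps)
  also have "\<dots> = (\<Sum>j\<in>block k. v j * cnj (v j))"
    unfolding sum_block_split[of _ k] T_def[symmetric] by simp
  finally have "complex_of_real (\<Sum>j\<in>block k. (cmod (reflect v j))\<^sup>2)
      = of_real (\<Sum>j\<in>block k. (cmod (v j))\<^sup>2)"
    by (simp add: complex_norm_square del: of_real_power)
  then show ?thesis by (simp only: of_real_eq_iff)
qed

lemma sum_norm_squared_reflect_first_blocks:
  "(\<Sum>j<block_start m. (cmod (reflect v j))\<^sup>2) = (\<Sum>j<block_start m. (cmod (v j))\<^sup>2)"
  by (simp add: sum_over_first_blocks sum_norm_squared_reflect)

text \<open>Pythagoras: subtracting the constant part removes the component along the constant unit vector.\<close>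

lemma sum_norm_squared_deviation:
  "(\<Sum>j\<in>block k. (cmod (c j - balance c k / 2 ^ k))\<^sup>2)
    = (\<Sum>j\<in>block k. (cmod (c j))\<^sup>2) - (cmod (balance c k))\<^sup>2"
proof -
  define a where "a = balance c k"
  have S: "(\<Sum>j\<in>block k. c j) = 2 ^ k * a" by (simp add: balance_def a_def)
  have cS: "(\<Sum>j\<in>block k. cnj (c j)) = 2 ^ k * cnj a" using arg_cong[OF S, of cnj] by simp
  define m where "m = a / 2 ^ k"
  have "(\<Sum>j\<in>block k. (c j - m) * cnj (c j - m))
      = (\<Sum>j\<in>block k. c j * cnj (c j)) - (\<Sum>j\<in>block k. c j) * cnj m
        - m * (\<Sum>j\<in>block k. cnj (c j)) + of_nat (card (block k)) * (m * cnj m)"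
    by (simp add: sum.distrib sum_subtractf sum_distrib_left sum_distrib_right
        left_diff_distrib right_diff_distrib)
  also have "\<dots> = (\<Sum>j\<in>block k. c j * cnj (c j)) - a * cnj a"
    unfolding S cS by (simp add: card_block power4_eq m_def)
  finally have "complex_of_real (\<Sum>j\<in>block k. (cmod (c j - m))\<^sup>2)
      = of_real ((\<Sum>j\<in>block k. (cmod (c j))\<^sup>2) - (cmod a)\<^sup>2)"
    by (simp add: complex_norm_square del: of_real_power)
  then show ?thesis by (simp only: of_real_eq_iff a_def m_def)
qed

text \<open>The Cauchy-Schwarz inequality on a block, read off from the fact that the squared deviation of
\<open>c\<close> restricted to \<open>A\<close> is nonnegative.\<close>

lemma norm_sum_block_le:
  assumes "A \<subseteq> block k"
  shows "cmod (\<Sum>j\<in>A. c j) / 2 ^ k \<le> sqrt (\<Sum>j\<in>A. (cmod (c j))\<^sup>2)"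
proof -
  define w where "w = (\<lambda>j. if j \<in> A then c j else 0)"
  have b: "balance w k = (\<Sum>j\<in>A. c j) / 2 ^ k"
    unfolding balance_def w_def using assms by (simp add: sum.If_cases Int_absorb1)
  have s: "(\<Sum>j\<in>block k. (cmod (w j))\<^sup>2) = (\<Sum>j\<in>A. (cmod (c j))\<^sup>2)"
    using assms by (intro sum.mono_neutral_cong_right) (auto simp: w_def)
  have "0 \<le> (\<Sum>j\<in>block k. (cmod (w j - balance w k / 2 ^ k))\<^sup>2)" by (intro sum_nonneg) auto
  then have "(cmod (balance w k))\<^sup>2 \<le> (\<Sum>j\<in>A. (cmod (c j))\<^sup>2)"
    unfolding sum_norm_squared_deviation s by simp
  then show ?thesis unfolding b by (intro real_le_rsqrt) (simp add: norm_divide norm_power)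
qed

section \<open>Square summable sequences and their place in the blocks\<close>

lemma ell2_nth_add: "ell2_nth (g + h) n = ell2_nth g n + ell2_nth h n"
  by transfer simp

lemma ell2_nth_zero [simp]: "ell2_nth 0 n = 0"
  by transfer simp

lemma ell2_nth_scaleC: "ell2_nth (c *\<^sub>C g) n = c * ell2_nth g n"
  by transfer simp

lemma ell2_nth_sum: "ell2_nth (\<Sum>a\<in>A. f a) n = (\<Sum>a\<in>A. ell2_nth (f a) n)"
  by (induction A rule: infinite_finite_induct) (auto simp: ell2_nth_add)

lemma bounded_linear_ell2_nth: "bounded_linear (\<lambda>g. ell2_nth g n)"
  by (rule bounded_linear_intro[where K = 1])
    (auto simp: ell2_nth_add ell2_nth_scaleC scaleR_scaleC scaleR_conv_of_real norm_ell2_nth_le)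

lemma sum_ell2_nth_le:
  assumes "finite F"
  shows "(\<Sum>n\<in>F. (cmod (ell2_nth g n))\<^sup>2) \<le> (norm g)\<^sup>2"
proof -
  obtain M where M: "F \<subseteq> {..<M}" using assms finite_nat_iff_bounded by blast
  have "(\<Sum>n\<in>F. (cmod (ell2_nth g n))\<^sup>2) \<le> (\<Sum>n<M. (cmod (ell2_nth g n))\<^sup>2)"
    using M by (intro sum_mono2) auto
  also have "\<dots> \<le> (norm g)\<^sup>2"
    using norm_ell2_le_iff[of "norm g" g] unfolding L2_set_def by (metis norm_ge_zero order_refl sqrt_le_D)
  finally show ?thesis .
qed

lemma norm_ell2_squared_leI:
  assumes "C \<ge> 0" "\<And>F. finite F \<Longrightarrow> (\<Sum>n\<in>F. (cmod (ell2_nth g n))\<^sup>2) \<le> C"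
  shows "(norm g)\<^sup>2 \<le> C"
proof -
  have "norm g \<le> sqrt C"
    using assms by (subst norm_ell2_le_iff) (auto simp: L2_set_def intro!: real_sqrt_le_mono)
  then have "(norm g)\<^sup>2 \<le> (sqrt C)\<^sup>2" by (intro power_mono) auto
  then show ?thesis using assms by simp
qed

text \<open>Tannery's theorem, applied to the series of the squared moduli of the differences.\<close>

lemma ell2_dominated_convergence:
  assumes lim: "\<And>n. (\<lambda>m. ell2_nth (G m) n) \<longlonglongrightarrow> ell2_nth g n"
    and dom: "\<And>m n. cmod (ell2_nth (G m) n - ell2_nth g n) \<le> cmod (ell2_nth g n)"
  shows "G \<longlonglongrightarrow> g"
proof -
  let ?h = "\<lambda>n m. (cmod (ell2_nth (G m) n - ell2_nth g n))\<^sup>2"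
  have "(\<lambda>m. \<Sum>n. ?h n m) \<longlonglongrightarrow> (\<Sum>n. 0)"
  proof (intro conjunct2[OF conjunct2[OF tannerys_theorem]])
    show "summable (\<lambda>n. (cmod (ell2_nth g n))\<^sup>2)" using ell2_nth by blast
    show "(\<lambda>m. ?h n m) \<longlonglongrightarrow> 0" for n
      using tendsto_power[OF tendsto_norm[OF LIM_zero[OF lim[of n]]], of 2] by simp
    show "\<forall>\<^sub>F (n, m) in sequentially \<times>\<^sub>F sequentially. norm (?h n m) \<le> (cmod (ell2_nth g n))\<^sup>2"
      by (rule always_eventually) (auto intro!: power_mono dom)
  qed simp
  moreover have "norm (G m - g) = sqrt (\<Sum>n. ?h n m)" for m
    unfolding ell2_nth_minus[symmetric] by transfer simp
  ultimately have "(\<lambda>m. norm (G m - g)) \<longlonglongrightarrow> 0"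
    using tendsto_real_sqrt[of _ 0 sequentially] by simp
  then show ?thesis by (rule Lim_null[THEN iffD2, OF tendsto_norm_zero_cancel])
qed

text \<open>The first index of a block will carry a coordinate of \<open>X\<close>, all others carry the coordinates of
\<open>\<ell>\<^sup>2\<close>; this function enumerates the latter.\<close>

definition off_start :: "nat \<Rightarrow> nat" where
  "off_start = enumerate (- range block_start)"

lemma bij_off_start: "bij_betw off_start UNIV (- range block_start)"
  unfolding off_start_def
proof (rule bij_enumerate)
  have "Suc (block_start (Suc k)) \<in> - range block_start" for k
  proof -
    have "level (Suc (block_start (Suc k))) = Suc k"
      using one_less_power[of "4::nat" "Suc k"] unfolding level_eq_iff block_start_Suc[of "Suc k"]
      by simp
    then have "Suc (block_start (Suc k)) \<noteq> block_start m" for m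
      by (metis level_block_start n_not_Suc_n)
    then show ?thesis by auto
  qed
  moreover have "inj (\<lambda>k. Suc (block_start (Suc k)))"
    using strict_mono_eq[OF strict_mono_block_start] by (auto intro: injI)
  ultimately show "infinite (- range block_start)"
    by (meson infinite_super range_inj_infinite image_subsetI)
qed

lemma inj_off_start: "inj off_start"
  using bij_off_start by (rule bij_betw_imp_inj_on)

lemma off_start_neq [simp]: "off_start n \<noteq> block_start k" "block_start k \<noteq> off_start n"
  using bij_off_start by (auto simp: bij_betw_def)

lemma off_start_inv: "j \<noteq> block_start (level j) \<Longrightarrow> off_start (inv off_start j) = j"
proof (rule f_inv_into_f)
  assume "j \<noteq> block_start (level j)"
  then have "j \<notin> range block_start" by auto
  then show "j \<in> range off_start" using bij_off_start by (auto simp: bij_betw_def)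
qed

lemma sum_off_start:
  assumes "D \<inter> range block_start = {}"
  shows "(\<Sum>j\<in>D. h j) = (\<Sum>n\<in>inv off_start ` D. h (off_start n))"
proof -
  have *: "off_start (inv off_start j) = j" if "j \<in> D" for j
    using that assms by (intro off_start_inv) blast
  then have "inj_on (inv off_start) D" by (metis inj_onI)
  then show ?thesis using * by (simp add: sum.reindex)
qed

section \<open>Spreading a basis over blocks\<close>

text \<open>The bound on the partial sums holds for every Schauder basis with some \<open>K\<close>; the estimates below
are stated in terms of it.\<close>

locale lifted_basis =
  fixes x :: "nat \<Rightarrow> 'a::complex_banach" and K :: real
  assumes normalized: "normalized_basis x"
    and K_ge_1: "1 \<le> K"
    and norm_partial_sum_le: "\<And>n z. norm (basis_projection x {..<n} z) \<le> K * norm z"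
begin

lemma schauder: "schauder_basis x" and norm_x [simp]: "norm (x k) = 1"
  using normalized by (auto simp: normalized_basis_def)

text \<open>The \<open>j\<close>-th row of the reflection, with the entry at the first index of the block placed in
\<open>X\<close> along \<open>x k\<close> and the other entries placed in \<open>\<ell>\<^sup>2\<close>. Orthogonality makes each of these
vectors have norm exactly \<open>1\<close>.\<close>

definition psi :: "nat \<Rightarrow> 'a \<times> ell2" where
  "psi j = ((1 / 2 ^ level j) *\<^sub>C x (level j),
     Abs_ell2 (\<lambda>n. reflect (\<lambda>i. if i = j then 1 else 0) (off_start n)))"

lemma reflect_unit_eq_0:
  assumes "level i \<noteq> level j"
  shows "reflect (\<lambda>i. if i = j then 1 else 0) i = 0"
proof -
  have "reflect (\<lambda>i. if i = j then 1 else 0) i = reflect (\<lambda>i. 0 * 0) i"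
    using assms by (intro reflect_cong) auto
  also have "\<dots> = 0" unfolding reflect_scale by simp
  finally show ?thesis .
qed

lemma ell2_nth_psi: "ell2_nth (snd (psi j)) n = reflect (\<lambda>i. if i = j then 1 else 0) (off_start n)"
proof -
  have "finite (off_start -` block (level j))"
    by (intro finite_vimageI inj_off_start finite_block)
  then have "summable (\<lambda>n. (cmod (reflect (\<lambda>i. if i = j then 1 else 0) (off_start n)))\<^sup>2)"
    by (rule summable_finite) (auto simp: reflect_unit_eq_0)
  then show ?thesis by (simp add: psi_def Abs_ell2_inverse)
qed

lemma fst_combination:
  assumes "finite A" "finite T" "level ` A \<subseteq> T"
  shows "fst (\<Sum>j\<in>A. c j *\<^sub>C psi j) = (\<Sum>k\<in>T. ((\<Sum>j\<in>A \<inter> block k. c j) / 2 ^ k) *\<^sub>C x k)"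
proof -
  have "fst (\<Sum>j\<in>A. c j *\<^sub>C psi j) = (\<Sum>j\<in>A. (c j / 2 ^ level j) *\<^sub>C x (level j))"
    by (simp add: fst_sum psi_def scaleC_scaleC)
  also have "\<dots> = (\<Sum>k\<in>T. \<Sum>j\<in>A \<inter> block k. (c j / 2 ^ level j) *\<^sub>C x (level j))"
    by (rule sum_over_levels[OF assms, symmetric])
  also have "\<dots> = (\<Sum>k\<in>T. ((\<Sum>j\<in>A \<inter> block k. c j) / 2 ^ k) *\<^sub>C x k)"
    unfolding sum_divide_distrib scaleC_sum_left by (intro sum.cong) auto
  finally show ?thesis .
qed

lemma snd_combination:
  assumes "finite A"
  shows "ell2_nth (snd (\<Sum>j\<in>A. c j *\<^sub>C psi j)) n
    = reflect (\<lambda>i. if i \<in> A then c i else 0) (off_start n)"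
proof -
  have "ell2_nth (snd (\<Sum>j\<in>A. c j *\<^sub>C psi j)) n
      = reflect (\<lambda>i. \<Sum>j\<in>A. c j * (if i = j then 1 else 0)) (off_start n)"
    by (simp add: snd_sum ell2_nth_sum ell2_nth_scaleC ell2_nth_psi reflect_sum reflect_scale)
  also have "(\<lambda>i. \<Sum>j\<in>A. c j * (if i = j then 1 else 0)) = (\<lambda>i. if i \<in> A then c i else 0)"
    using assms by (auto simp: if_distrib cong: if_cong)
  finally show ?thesis .
qed

text \<open>The reflection preserves the norm on the first blocks, taken so many that they contain both \<open>A\<close> and
the positions of the coordinates in \<open>F\<close>.\<close>

lemma norm_snd_combination_le:
  assumes "finite A"
  shows "(norm (snd (\<Sum>j\<in>A. c j *\<^sub>C psi j)))\<^sup>2 \<le> (\<Sum>j\<in>A. (cmod (c j))\<^sup>2)"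
proof (rule norm_ell2_squared_leI)
  fix F :: "nat set" assume "finite F"
  define w where "w = (\<lambda>i. if i \<in> A then c i else 0)"
  have "finite (A \<union> off_start ` F)" using assms \<open>finite F\<close> by simp
  then obtain m where m: "A \<union> off_start ` F \<subseteq> {..<block_start m}" by (rule finite_first_blocks)
  have "(\<Sum>n\<in>F. (cmod (ell2_nth (snd (\<Sum>j\<in>A. c j *\<^sub>C psi j)) n))\<^sup>2)
      = (\<Sum>j\<in>off_start ` F. (cmod (reflect w j))\<^sup>2)"
    using inj_on_subset[OF inj_off_start, of F]
    by (simp add: snd_combination[OF assms] w_def sum.reindex)
  also have "\<dots> \<le> (\<Sum>j<block_start m. (cmod (reflect w j))\<^sup>2)"
    using m by (intro sum_mono2) auto
  also have "\<dots> = (\<Sum>j<block_start m. (cmod (w j))\<^sup>2)" by (rule sum_norm_squared_reflect_first_blocks)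
  also have "\<dots> = (\<Sum>j\<in>A. (cmod (c j))\<^sup>2)"
    using m by (intro sum.mono_neutral_cong_right) (auto simp: w_def)
  finally show "(\<Sum>n\<in>F. (cmod (ell2_nth (snd (\<Sum>j\<in>A. c j *\<^sub>C psi j)) n))\<^sup>2)
    \<le> (\<Sum>j\<in>A. (cmod (c j))\<^sup>2)" .
qed (simp add: sum_nonneg)

text \<open>The upper estimate on which everything rests. As \<open>x\<close> is an arbitrary basis, nothing better than the
triangle inequality is available in \<open>X\<close>; the exponential growth of the blocks makes up for it.\<close>

lemma norm_combination_le:
  assumes "finite A" "finite T" "level ` A \<subseteq> T"
  shows "norm (\<Sum>j\<in>A. c j *\<^sub>C psi j)
    \<le> (\<Sum>k\<in>T. cmod (\<Sum>j\<in>A \<inter> block k. c j) / 2 ^ k) + sqrt (\<Sum>j\<in>A. (cmod (c j))\<^sup>2)"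
proof -
  let ?f = "\<Sum>j\<in>A. c j *\<^sub>C psi j"
  have "norm ?f \<le> norm (fst ?f) + norm (snd ?f)"
    using norm_Pair_le[of "fst ?f" "snd ?f"] by simp
  also have "norm (fst ?f) \<le> (\<Sum>k\<in>T. cmod (\<Sum>j\<in>A \<inter> block k. c j) / 2 ^ k)"
    unfolding fst_combination[OF assms]
    by (rule sum_norm_le) (simp add: norm_scaleC norm_divide norm_power)
  also have "norm (snd ?f) \<le> sqrt (\<Sum>j\<in>A. (cmod (c j))\<^sup>2)"
    by (intro real_le_rsqrt norm_snd_combination_le assms)
  finally show ?thesis by simp
qed

text \<open>The \<open>\<ell>\<^sup>2\<close> component has finite support, and a row of an orthogonal matrix has norm \<open>1\<close>.\<close>

lemma norm_psi: "norm (psi j) = 1"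
proof -
  define k where "k = level j"
  define w where "w = reflect (\<lambda>i. if i = j then 1 else 0)"
  define D where "D = block k - {block_start k}"
  define F where "F = inv off_start ` D"
  have "(\<Sum>i\<in>block k. (cmod (w i))\<^sup>2) = (\<Sum>i\<in>block k. if i = j then 1 else 0)"
    unfolding w_def sum_norm_squared_reflect by (intro sum.cong) auto
  then have "(\<Sum>i\<in>block k. (cmod (w i))\<^sup>2) = 1" by (simp add: k_def)
  moreover have "w (block_start k) = 1 / 2 ^ k"
    by (simp add: w_def reflect_on_block(3) balance_def k_def)
  ultimately have "(\<Sum>i\<in>D. (cmod (w i))\<^sup>2) = 1 - (1 / 2 ^ k)\<^sup>2"
    unfolding sum_block_split[of _ k] D_def by (simp add: norm_divide norm_power)
  moreover have "D \<inter> range block_start = {}" by (auto simp: D_def)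
  ultimately have F: "(\<Sum>n\<in>F. (cmod (ell2_nth (snd (psi j)) n))\<^sup>2) = 1 - (1 / 2 ^ k)\<^sup>2"
    unfolding F_def ell2_nth_psi w_def by (simp add: sum_off_start)
  have 1: "1 - (1 / 2 ^ k)\<^sup>2 \<le> (norm (snd (psi j)))\<^sup>2"
    unfolding F[symmetric] by (rule sum_ell2_nth_le) (simp add: F_def D_def)
  have zero: "ell2_nth (snd (psi j)) n = 0" if "n \<notin> F" for n
  proof -
    have "off_start n \<notin> D" using that by (auto simp: F_def image_iff inv_f_f[OF inj_off_start])
    then show ?thesis unfolding ell2_nth_psi by (intro reflect_unit_eq_0) (auto simp: D_def k_def)
  qed
  have 2: "(norm (snd (psi j)))\<^sup>2 \<le> 1 - (1 / 2 ^ k)\<^sup>2"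
  proof (rule norm_ell2_squared_leI)
    show "0 \<le> 1 - (1 / 2 ^ k :: real)\<^sup>2" unfolding F[symmetric] by (intro sum_nonneg) auto
    fix G :: "nat set" assume "finite G"
    then have "(\<Sum>n\<in>G. (cmod (ell2_nth (snd (psi j)) n))\<^sup>2)
        = (\<Sum>n\<in>G \<inter> F. (cmod (ell2_nth (snd (psi j)) n))\<^sup>2)"
      using zero by (intro sum.mono_neutral_right) auto
    also have "\<dots> \<le> 1 - (1 / 2 ^ k)\<^sup>2"
      unfolding F[symmetric] by (intro sum_mono2) (auto simp: F_def D_def)
    finally show "(\<Sum>n\<in>G. (cmod (ell2_nth (snd (psi j)) n))\<^sup>2) \<le> 1 - (1 / 2 ^ k)\<^sup>2" .
  qed
  have "(norm (psi j))\<^sup>2 = (1 / 2 ^ k)\<^sup>2 + (norm (snd (psi j)))\<^sup>2"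
    by (simp add: norm_prod_def psi_def norm_scaleC norm_divide norm_power k_def)
  then have "(norm (psi j))\<^sup>2 = 1\<^sup>2" using 1 2 by simp
  then show ?thesis by (rule power2_eq_imp_eq) auto
qed

text \<open>The concatenation of the coordinates in \<open>X\<close> and in \<open>\<ell>\<^sup>2\<close>, which the reflection turns into the
coefficients with respect to \<open>psi\<close>.\<close>

definition coords :: "'a \<times> ell2 \<Rightarrow> nat \<Rightarrow> complex" where
  "coords f j = (if j = block_start (level j) then coefficients x (fst f) (level j)
     else ell2_nth (snd f) (inv off_start j))"

lemma coords_block_start [simp]: "coords f (block_start k) = coefficients x (fst f) k"
  by (simp add: coords_def)

lemma coords_off_start [simp]: "coords f (off_start n) = ell2_nth (snd f) n"
  by (simp add: coords_def inv_f_f[OF inj_off_start])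

definition expansion :: "'a \<times> ell2 \<Rightarrow> nat \<Rightarrow> complex" where
  "expansion f = reflect (coords f)"

lemma balance_expansion: "balance (expansion f) k = coefficients x (fst f) k"
  by (simp add: expansion_def balance_reflect)

definition initial :: "nat \<Rightarrow> 'a \<times> ell2 \<Rightarrow> 'a \<times> ell2" where
  "initial m f = (\<Sum>j<block_start m. expansion f j *\<^sub>C psi j)"

lemma fst_combination_initial:
  "fst (\<Sum>j<block_start m. c j *\<^sub>C psi j) = (\<Sum>k<m. balance c k *\<^sub>C x k)"
proof -
  have "{..<block_start m} \<inter> block k = block k" if "k < m" for k
    using that by (auto simp flip: level_less_iff)
  then show ?thesis
    by (subst fst_combination[where T = "{..<m}"]) (auto simp: level_less_iff balance_def)
qed

lemma fst_initial: "fst (initial m f) = basis_projection x {..<m} (fst f)"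
  by (simp add: initial_def fst_combination_initial balance_expansion basis_projection_def)

lemma snd_initial:
  "ell2_nth (snd (initial m f)) n = (if level (off_start n) < m then ell2_nth (snd f) n else 0)"
proof -
  have "ell2_nth (snd (initial m f)) n
      = reflect (\<lambda>i. if level i < m then expansion f i else 0) (off_start n)"
    by (simp add: initial_def snd_combination level_less_iff)
  also have "\<dots> = reflect (\<lambda>i. (if level (off_start n) < m then 1 else 0) * expansion f i) (off_start n)"
    by (rule reflect_cong) auto
  finally show ?thesis by (simp add: reflect_scale expansion_def)
qed

lemma norm_initial_le: "norm (initial m f) \<le> K * norm f"
proof -
  have "norm (snd (initial m f)) \<le> norm (snd f)"
  proof (rule power2_le_imp_le[OF norm_ell2_squared_leI])
    fix F :: "nat set" assume "finite F"
    have "(\<Sum>n\<in>F. (cmod (ell2_nth (snd (initial m f)) n))\<^sup>2) \<le> (\<Sum>n\<in>F. (cmod (ell2_nth (snd f) n))\<^sup>2)"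
      by (intro sum_mono) (simp add: snd_initial)
    also have "\<dots> \<le> (norm (snd f))\<^sup>2" by (rule sum_ell2_nth_le[OF \<open>finite F\<close>])
    finally show "(\<Sum>n\<in>F. (cmod (ell2_nth (snd (initial m f)) n))\<^sup>2) \<le> (norm (snd f))\<^sup>2" .
  qed auto
  also have "\<dots> \<le> K * norm (snd f)" using K_ge_1 mult_right_mono[of 1 K "norm (snd f)"] by simp
  finally have "sqrt ((norm (fst (initial m f)))\<^sup>2 + (norm (snd (initial m f)))\<^sup>2)
      \<le> sqrt ((K * norm (fst f))\<^sup>2 + (K * norm (snd f))\<^sup>2)"
    by (intro real_sqrt_le_mono add_mono power_mono) (auto simp: fst_initial norm_partial_sum_le)
  also have "\<dots> = K * norm f"
    using K_ge_1 by (simp add: norm_prod_def power_mult_distrib real_sqrt_mult flip: distrib_left)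
  finally show ?thesis by (simp add: norm_prod_def)
qed

lemma tendsto_initial: "(\<lambda>m. initial m f) \<longlonglongrightarrow> f"
proof -
  have "(\<lambda>m. fst (initial m f)) \<longlonglongrightarrow> fst f"
    using coefficients_sums[OF schauder, of "fst f"]
    by (simp add: fst_initial basis_projection_def sums_def)
  moreover have "(\<lambda>m. snd (initial m f)) \<longlonglongrightarrow> snd f"
  proof (rule ell2_dominated_convergence)
    fix n
    have "\<forall>\<^sub>F m in sequentially. ell2_nth (snd f) n = ell2_nth (snd (initial m f)) n"
      using eventually_gt_at_top[of "level (off_start n)"]
      by eventually_elim (simp add: snd_initial)
    then show "(\<lambda>m. ell2_nth (snd (initial m f)) n) \<longlonglongrightarrow> ell2_nth (snd f) n"
      by (rule Lim_transform_eventually[OF tendsto_const])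
  qed (auto simp: snd_initial)
  ultimately have "(\<lambda>m. (fst (initial m f), snd (initial m f))) \<longlonglongrightarrow> (fst f, snd f)"
    by (rule tendsto_Pair)
  then show ?thesis by simp
qed

lemma coords_tail:
  "(\<Sum>j\<in>D - range block_start. (cmod (coords f j))\<^sup>2)
    = (\<Sum>n\<in>inv off_start ` (D - range block_start). (cmod (ell2_nth (snd f) n))\<^sup>2)"
  by (subst sum_off_start) auto

text \<open>Both terms on the right tend to \<open>0\<close> as \<open>m\<close> grows, which controls the partial sums that end within a
block.\<close>

lemma sum_norm_squared_expansion_block:
  "(\<Sum>j\<in>block m. (cmod (expansion f j))\<^sup>2)
    \<le> (cmod (coefficients x (fst f) m))\<^sup>2 + (norm (snd (f - initial m f)))\<^sup>2"
proof -
  have D: "block m - {block_start m} = block m - range block_start" by auto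
  let ?F = "inv off_start ` (block m - range block_start)"
  have "(\<Sum>j\<in>block m. (cmod (expansion f j))\<^sup>2) = (\<Sum>j\<in>block m. (cmod (coords f j))\<^sup>2)"
    unfolding expansion_def by (rule sum_norm_squared_reflect)
  also have "\<dots> = (cmod (coefficients x (fst f) m))\<^sup>2 + (\<Sum>n\<in>?F. (cmod (ell2_nth (snd f) n))\<^sup>2)"
    unfolding sum_block_split[of _ m] D coords_tail by simp
  also have "(\<Sum>n\<in>?F. (cmod (ell2_nth (snd f) n))\<^sup>2)
      = (\<Sum>n\<in>?F. (cmod (ell2_nth (snd (f - initial m f)) n))\<^sup>2)"
  proof (rule sum.cong[OF refl])
    fix n assume "n \<in> ?F"
    then obtain j where "level j = m" "j \<notin> range block_start" "n = inv off_start j" by auto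
    then have "level (off_start n) = m" by (subst \<open>n = _\<close>, subst off_start_inv) auto
    then show "(cmod (ell2_nth (snd f) n))\<^sup>2 = (cmod (ell2_nth (snd (f - initial m f)) n))\<^sup>2"
      by (simp add: ell2_nth_minus snd_initial)
  qed
  also have "\<dots> \<le> (norm (snd (f - initial m f)))\<^sup>2" by (rule sum_ell2_nth_le) simp
  finally show ?thesis by simp
qed

text \<open>The partial sums over whole blocks converge by \<open>tendsto_initial\<close>, and a partial sum ending inside
block \<open>m\<close> differs from one of these by at most twice the \<open>\<ell>\<^sup>2\<close>-norm of the coefficients in that
block.\<close>

lemma expansion_sums: "(\<lambda>j. expansion f j *\<^sub>C psi j) sums f"
proof -
  define P where "P = (\<lambda>n. \<Sum>j<n. expansion f j *\<^sub>C psi j)"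
  define err where "err = (\<lambda>m. norm (initial m f - f)
    + 2 * sqrt ((cmod (coefficients x (fst f) m))\<^sup>2 + (norm (snd (f - initial m f)))\<^sup>2))"
  have lvl: "filterlim level at_top sequentially"
    unfolding filterlim_at_top
  proof
    fix m
    show "\<forall>\<^sub>F n in sequentially. m \<le> level n"
      using eventually_ge_at_top[of "block_start m"]
      by eventually_elim (metis level_less_iff not_le)
  qed
  have "norm (P n - f) \<le> err (level n)" for n
  proof -
    define m where "m = level n"
    \<comment> \<open>The partial sum is cut at the start of the block in which it ends.\<close>
  define A where "A = {block_start m..<n}"
    have n: "block_start m \<le> n" "n < block_start (Suc m)" using level_eq_iff[of n m] by (auto simp: m_def)
    then have A: "A \<subseteq> block m" by (auto simp: A_def block_eq)
    then have A': "finite A" "level ` A \<subseteq> {m}" "A \<inter> block m = A" by (auto simp: A_def)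
    have "P n = initial m f + (\<Sum>j\<in>A. expansion f j *\<^sub>C psi j)"
      using sum.atLeastLessThan_concat[of 0 "block_start m" n "\<lambda>j. expansion f j *\<^sub>C psi j"] n(1)
      by (simp add: P_def initial_def A_def atLeast0LessThan)
    then have "norm (P n - f) \<le> norm (initial m f - f) + norm (\<Sum>j\<in>A. expansion f j *\<^sub>C psi j)"
      using norm_triangle_ineq[of "initial m f - f" "\<Sum>j\<in>A. expansion f j *\<^sub>C psi j"]
      by (simp add: algebra_simps)
    also have "norm (\<Sum>j\<in>A. expansion f j *\<^sub>C psi j)
        \<le> cmod (\<Sum>j\<in>A. expansion f j) / 2 ^ m + sqrt (\<Sum>j\<in>A. (cmod (expansion f j))\<^sup>2)"
      using norm_combination_le[OF A'(1) _ A'(2), of "expansion f"] A'(3) by simp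
    also have "\<dots> \<le> 2 * sqrt (\<Sum>j\<in>A. (cmod (expansion f j))\<^sup>2)"
      using norm_sum_block_le[OF A, of "expansion f"] by simp
    also have "(\<Sum>j\<in>A. (cmod (expansion f j))\<^sup>2) \<le> (\<Sum>j\<in>block m. (cmod (expansion f j))\<^sup>2)"
      using A by (intro sum_mono2) auto
    also note sum_norm_squared_expansion_block
    finally show ?thesis by (simp add: err_def m_def)
  qed
  moreover have "(\<lambda>n. err (level n)) \<longlonglongrightarrow> 0"
  proof (rule filterlim_compose[OF _ lvl])
    have "err \<longlonglongrightarrow> norm (f - f) + 2 * sqrt ((cmod 0)\<^sup>2 + (norm (snd (f - f)))\<^sup>2)"
      unfolding err_def
      by (intro tendsto_intros tendsto_initial coefficients_tendsto_0[OF normalized])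
    then show "err \<longlonglongrightarrow> 0" by simp
  qed
  ultimately have "(\<lambda>n. P n - f) \<longlonglongrightarrow> 0"
    by (intro Lim_null_comparison[of "\<lambda>n. P n - f" "\<lambda>n. err (level n)"] always_eventually) auto
  then show ?thesis
    unfolding sums_def P_def by (rule Lim_null[THEN iffD2])
qed

text \<open>Every coordinate is recovered by continuity: those in \<open>X\<close> from the uniqueness of \<open>x\<close>-expansions
along the sums over whole blocks, those in \<open>\<ell>\<^sup>2\<close> because they are constant from some partial sum
on.\<close>

lemma expansion_unique:
  assumes "(\<lambda>j. a j *\<^sub>C psi j) sums f"
  shows "a = expansion f"
proof -
  have lim: "(\<lambda>n. \<Sum>j<n. a j *\<^sub>C psi j) \<longlonglongrightarrow> f" using assms by (simp add: sums_def)
  have "reflect a j = coords f j" for j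
  proof (cases "j = block_start (level j)")
    case True
    have "(\<lambda>m. \<Sum>j<block_start m. a j *\<^sub>C psi j) \<longlonglongrightarrow> f"
      using LIMSEQ_subseq_LIMSEQ[OF lim strict_mono_block_start] by (simp add: o_def)
    then have "(\<lambda>m. fst (\<Sum>j<block_start m. a j *\<^sub>C psi j)) \<longlonglongrightarrow> fst f" by (rule tendsto_fst)
    then have "(\<lambda>k. balance a k *\<^sub>C x k) sums fst f" by (simp add: fst_combination_initial sums_def)
    then have "coefficients x (fst f) = balance a" by (rule coefficients_eqI[OF schauder])
    then show ?thesis by (subst True, subst (2) True) (simp add: reflect_on_block(3))
  next
    case False
    define n where "n = inv off_start j"
    have j: "j = off_start n" using off_start_inv[OF False] by (simp add: n_def)
    have "(\<lambda>N. ell2_nth (snd (\<Sum>j<N. a j *\<^sub>C psi j)) n) \<longlonglongrightarrow> ell2_nth (snd f) n"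
      by (intro bounded_linear.tendsto[OF bounded_linear_ell2_nth] tendsto_snd lim)
    moreover have "\<forall>\<^sub>F N in sequentially. ell2_nth (snd (\<Sum>j<N. a j *\<^sub>C psi j)) n = reflect a j"
      using eventually_ge_at_top[of "block_start (Suc (level j))"]
    proof eventually_elim
      case (elim N)
      have "reflect (\<lambda>i. if i < N then a i else 0) j = reflect a j"
        using elim by (intro reflect_cong) (use level_eq_iff in fastforce)
      then show ?case by (simp add: snd_combination j)
    qed
    ultimately have "ell2_nth (snd f) n = reflect a j"
      by (rule LIMSEQ_unique[OF _ tendsto_eventually])
    then show ?thesis by (simp add: j)
  qed
  then have "reflect a = coords f" by auto
  then show ?thesis by (metis expansion_def reflect_reflect)
qed

lemma normalized_psi: "normalized_basis psi"
  unfolding normalized_basis_def schauder_basis_def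
  using expansion_sums expansion_unique norm_psi by blast

lemma schauder_psi: "schauder_basis psi"
  using normalized_psi by (simp add: normalized_basis_def)

lemma coefficients_psi: "coefficients psi f = expansion f"
  by (rule coefficients_eqI[OF schauder_psi expansion_sums])

section \<open>Bounds for coefficients and deviations\<close>

text \<open>The part of the coefficients whose sum over each block vanishes.\<close>

definition deviation :: "'a \<times> ell2 \<Rightarrow> nat \<Rightarrow> complex" where
  "deviation f j = expansion f j - coefficients x (fst f) (level j) / 2 ^ level j"

lemma norm_coefficient_le: "cmod (coefficients x z k) \<le> 2 * K * norm z"
proof -
  have eq: "coefficients x z k *\<^sub>C x k = basis_projection x {..<Suc k} z - basis_projection x {..<k} z"
    by (simp add: basis_projection_def)
  have "norm (coefficients x z k *\<^sub>C x k) \<le> K * norm z + K * norm z"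
    unfolding eq using norm_triangle_ineq4[of "basis_projection x {..<Suc k} z" "basis_projection x {..<k} z"]
      norm_partial_sum_le[of "Suc k" z] norm_partial_sum_le[of k z] by linarith
  then show ?thesis by (simp add: norm_scaleC)
qed

lemma norm_fst_coefficient_le: "cmod (coefficients x (fst f) k) \<le> 2 * K * norm f"
proof -
  have "norm (fst f) \<le> norm f" by (metis norm_fst_le prod.collapse)
  then show ?thesis using norm_coefficient_le[of "fst f" k] K_ge_1
    by (meson mult_left_mono order_trans zero_le_mult_iff zero_le_numeral zero_le_one)
qed

text \<open>In each block, Pythagoras removes the coordinate along \<open>x k\<close>, which sits at the first index; what
remains are coordinates in \<open>\<ell>\<^sup>2\<close>.\<close>

lemma sum_norm_squared_deviation_le:
  assumes "finite A"
  shows "(\<Sum>j\<in>A. (cmod (deviation f j))\<^sup>2) \<le> (norm f)\<^sup>2"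
proof -
  obtain m where m: "A \<subseteq> {..<block_start m}" using finite_first_blocks[OF assms] .
  define D where "D = {..<block_start m} - range block_start"
  have "(\<Sum>j\<in>A. (cmod (deviation f j))\<^sup>2) \<le> (\<Sum>j<block_start m. (cmod (deviation f j))\<^sup>2)"
    using m by (intro sum_mono2) auto
  also have "\<dots> = (\<Sum>k<m. \<Sum>j\<in>block k.
      (cmod (expansion f j - balance (expansion f) k / 2 ^ k))\<^sup>2)"
    unfolding sum_over_first_blocks by (intro sum.cong) (auto simp: deviation_def balance_expansion)
  also have "\<dots> = (\<Sum>k<m. \<Sum>j\<in>D \<inter> block k. (cmod (coords f j))\<^sup>2)"
  proof (rule sum.cong[OF refl])
    fix k assume k: "k \<in> {..<m}"
    have "D \<inter> block k = block k - {block_start k}"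
      using k by (auto simp: D_def simp flip: level_less_iff)
    then show "(\<Sum>j\<in>block k. (cmod (expansion f j - balance (expansion f) k / 2 ^ k))\<^sup>2)
        = (\<Sum>j\<in>D \<inter> block k. (cmod (coords f j))\<^sup>2)"
      unfolding sum_norm_squared_deviation
      using sum_block_split[of "\<lambda>j. (cmod (coords f j))\<^sup>2" k]
      by (simp add: expansion_def sum_norm_squared_reflect balance_reflect)
  qed
  also have "\<dots> = (\<Sum>j\<in>D. (cmod (coords f j))\<^sup>2)"
    by (rule sum_over_levels) (auto simp: D_def level_less_iff)
  also have "\<dots> = (\<Sum>n\<in>inv off_start ` D. (cmod (ell2_nth (snd f) n))\<^sup>2)"
    unfolding D_def by (rule coords_tail)
  also have "\<dots> \<le> (norm (snd f))\<^sup>2" by (rule sum_ell2_nth_le) (simp add: D_def)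
  also have "\<dots> \<le> (norm f)\<^sup>2" by (intro power_mono) (metis norm_snd_le prod.collapse, simp)
  finally show ?thesis .
qed

section \<open>Quasi-greediness\<close>

text \<open>Controls what a greedy sum omits from the first \<open>m\<close> blocks. Block \<open>k\<close> contributes at most
\<open>t * 2 ^ k\<close> to the first sum in \<open>norm_combination_le\<close> and \<open>(t * 2 ^ k)\<^sup>2\<close> to the second; both
series are geometric and dominated by their last terms, which are at most \<open>a\<close> and \<open>a\<^sup>2\<close>.\<close>

lemma norm_small_coefficients_le:
  assumes E: "E \<subseteq> {..<block_start m}" and t: "t > 0"
    and c: "\<And>j. j \<in> E \<Longrightarrow> cmod (c j) \<le> t"
    and m: "\<And>k. k < m \<Longrightarrow> t * 2 ^ k \<le> a" and "a \<ge> 0"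
  shows "norm (\<Sum>j\<in>E. c j *\<^sub>C psi j) \<le> 4 * a"
proof -
  have fE: "finite E" using E finite_subset by blast
  have geo: "(\<Sum>k<m. 2 ^ k :: real) \<le> 2 * (a / t)"
    using m t \<open>a \<ge> 0\<close> by (intro sum_powers_of_2_le) (auto simp: field_simps)
  have "cmod (\<Sum>j\<in>E \<inter> block k. c j) / 2 ^ k \<le> t * 2 ^ k" for k
  proof -
    have "cmod (\<Sum>j\<in>E \<inter> block k. c j) \<le> (\<Sum>j\<in>E \<inter> block k. t)"
      using c by (intro sum_norm_le) auto
    also have "\<dots> \<le> 4 ^ k * t"
      using t mult_right_mono[OF card_inter_block_le[of E k], of t] by simp
    finally show ?thesis by (simp add: power4_eq field_simps)
  qed
  then have "(\<Sum>k<m. cmod (\<Sum>j\<in>E \<inter> block k. c j) / 2 ^ k) \<le> (\<Sum>k<m. t * 2 ^ k)"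
    by (rule sum_mono)
  also have "\<dots> \<le> 2 * a" using geo t by (simp add: field_simps flip: sum_distrib_left)
  finally have 1: "(\<Sum>k<m. cmod (\<Sum>j\<in>E \<inter> block k. c j) / 2 ^ k) \<le> 2 * a" .
  have "(\<Sum>j\<in>E. (cmod (c j))\<^sup>2) \<le> (\<Sum>j\<in>E. t\<^sup>2)"
    using c by (intro sum_mono power_mono) auto
  also have "\<dots> \<le> (\<Sum>j<block_start m. t\<^sup>2)" using E by (intro sum_mono2) auto
  also have "\<dots> = (\<Sum>k<m. (t * 2 ^ k) * (t * 2 ^ k))"
    unfolding sum_over_first_blocks by (simp add: card_block power4_eq power2_eq_square ac_simps)
  also have "\<dots> \<le> (\<Sum>k<m. a * (t * 2 ^ k))"
    using m t by (intro sum_mono mult_right_mono) auto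
  also have "\<dots> \<le> a * (2 * a)"
    using geo t \<open>a \<ge> 0\<close> unfolding sum_distrib_left[symmetric]
    by (intro mult_left_mono) (auto simp: field_simps)
  also have "\<dots> \<le> (2 * a)\<^sup>2" by (simp add: power2_eq_square)
  finally have 2: "sqrt (\<Sum>j\<in>E. (cmod (c j))\<^sup>2) \<le> 2 * a"
    using \<open>a \<ge> 0\<close> by (intro real_le_lsqrt) auto
  have "level ` E \<subseteq> {..<m}" using E by (auto simp: level_less_iff)
  from norm_combination_le[OF fE _ this, of c] 1 2 show ?thesis by simp
qed

text \<open>Controls what a greedy sum selects from the later blocks. As the constant part
\<open>c j - d j\<close> has modulus at most \<open>t / 2\<close>, the modulus of \<open>d j\<close> is at least \<open>t / 2\<close> and at least half of
that of \<open>c j\<close>. This trades a sum of moduli for a sum of squares, at the cost of a factor \<open>4 / t\<close> that the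
weight \<open>2 ^ (- k)\<close> with \<open>k \<ge> m\<close> absorbs.\<close>

lemma norm_large_coefficients_le:
  assumes fH: "finite H" and t: "t > 0"
    and c: "\<And>j. j \<in> H \<Longrightarrow> t \<le> cmod (c j) \<and> cmod (c j - d j) \<le> t / 2"
    and lev: "\<And>j. j \<in> H \<Longrightarrow> m \<le> level j"
    and d: "(\<Sum>j\<in>H. (cmod (d j))\<^sup>2) \<le> R\<^sup>2" and R: "0 \<le> R" "4 * R \<le> t * 2 ^ m"
  shows "norm (\<Sum>j\<in>H. c j *\<^sub>C psi j) \<le> 3 * R"
proof -
  have d2: "t / 2 \<le> cmod (d j)" "cmod (c j) \<le> 2 * cmod (d j)" if "j \<in> H" for j
    using c[OF that] norm_triangle_ineq2[of "c j" "d j"] by auto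
  have d4: "cmod (c j) \<le> 4 / t * (cmod (d j))\<^sup>2" if "j \<in> H" for j
  proof -
    have "t * cmod (c j) \<le> (2 * cmod (d j)) * (2 * cmod (d j))"
      using d2[OF that] t by (intro mult_mono) auto
    then show ?thesis using t by (simp add: field_simps power2_eq_square)
  qed
  have "(\<Sum>k\<in>level ` H. cmod (\<Sum>j\<in>H \<inter> block k. c j) / 2 ^ k)
      \<le> (\<Sum>k\<in>level ` H. \<Sum>j\<in>H \<inter> block k. 4 / t * (cmod (d j))\<^sup>2 / 2 ^ m)"
  proof (rule sum_mono)
    fix k assume "k \<in> level ` H"
    then have k: "m \<le> k" using lev by auto
    have "cmod (\<Sum>j\<in>H \<inter> block k. c j) \<le> (\<Sum>j\<in>H \<inter> block k. 4 / t * (cmod (d j))\<^sup>2)"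
      using d4 by (intro sum_norm_le) auto
    then have "cmod (\<Sum>j\<in>H \<inter> block k. c j) / 2 ^ k
        \<le> (\<Sum>j\<in>H \<inter> block k. 4 / t * (cmod (d j))\<^sup>2) / 2 ^ m"
      using k t by (intro frac_le sum_nonneg) auto
    then show "cmod (\<Sum>j\<in>H \<inter> block k. c j) / 2 ^ k
        \<le> (\<Sum>j\<in>H \<inter> block k. 4 / t * (cmod (d j))\<^sup>2 / 2 ^ m)"
      by (simp add: sum_divide_distrib)
  qed
  also have "\<dots> = (\<Sum>j\<in>H. 4 / t * (cmod (d j))\<^sup>2 / 2 ^ m)"
    using fH by (intro sum_over_levels) auto
  also have "\<dots> = 4 / (t * 2 ^ m) * (\<Sum>j\<in>H. (cmod (d j))\<^sup>2)"
    by (simp add: sum_distrib_left)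
  also have "\<dots> \<le> 4 / (t * 2 ^ m) * R\<^sup>2" using d t by (intro mult_left_mono) auto
  also have "\<dots> \<le> R"
    using mult_right_mono[OF R(2,1)] t by (simp add: field_simps power2_eq_square)
  finally have 1: "(\<Sum>k\<in>level ` H. cmod (\<Sum>j\<in>H \<inter> block k. c j) / 2 ^ k) \<le> R" .
  have "(\<Sum>j\<in>H. (cmod (c j))\<^sup>2) \<le> (\<Sum>j\<in>H. (2 * cmod (d j))\<^sup>2)"
    using d2 by (intro sum_mono power_mono) auto
  also have "\<dots> \<le> (2 * R)\<^sup>2" using d by (simp add: power_mult_distrib flip: sum_distrib_left)
  finally have 2: "sqrt (\<Sum>j\<in>H. (cmod (c j))\<^sup>2) \<le> 2 * R"
    using R by (intro real_le_lsqrt) auto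
  have "norm (\<Sum>j\<in>H. c j *\<^sub>C psi j)
      \<le> (\<Sum>k\<in>level ` H. cmod (\<Sum>j\<in>H \<inter> block k. c j) / 2 ^ k) + sqrt (\<Sum>j\<in>H. (cmod (c j))\<^sup>2)"
    using fH by (intro norm_combination_le) auto
  then show ?thesis using 1 2 by simp
qed

text \<open>With \<open>m\<close> the first level at which the bound \<open>2 * K * norm f / 2 ^ m\<close> on the constant part drops below
\<open>t / 2\<close>, the greedy sum is the partial
sum over the first \<open>m\<close> blocks, minus the small coefficients omitted there, plus the large
coefficients selected later.\<close>

lemma norm_greedy_sum_le:
  assumes "greedy_set psi f N \<Lambda>"
  shows "norm (basis_projection psi \<Lambda> f) \<le> 20 * K * norm f"
proof -
  define c where "c = expansion f"
  have \<Lambda>: "finite \<Lambda>" "\<And>i j. i \<in> \<Lambda> \<Longrightarrow> j \<notin> \<Lambda> \<Longrightarrow> cmod (c j) \<le> cmod (c i)"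
    using assms by (auto simp: greedy_set_def coefficients_psi c_def)
  have proj: "basis_projection psi A f = (\<Sum>j\<in>A. c j *\<^sub>C psi j)" for A
    by (simp add: basis_projection_def coefficients_psi c_def)
  have Kf: "norm f \<le> K * norm f" using K_ge_1 mult_right_mono[of 1 K "norm f"] by simp
  show ?thesis
  proof (cases "\<Lambda> = {} \<or> (\<exists>i\<in>\<Lambda>. c i = 0)")
    case True
    then show ?thesis
    proof
      assume "\<exists>i\<in>\<Lambda>. c i = 0"
      then have "c j = 0" if "j \<notin> \<Lambda>" for j using \<Lambda>(2) that by fastforce
      then have "(\<lambda>j. c j *\<^sub>C psi j) sums (\<Sum>j\<in>\<Lambda>. c j *\<^sub>C psi j)"
        using \<Lambda>(1) by (intro sums_finite) auto
      then have eq: "basis_projection psi \<Lambda> f = f"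
        unfolding proj using expansion_sums[of f] by (simp add: c_def sums_unique2)
      show ?thesis unfolding eq using Kf norm_ge_zero[of f] by linarith
    qed (use K_ge_1 in \<open>simp add: basis_projection_def\<close>)
  next
    case False
    \<comment> \<open>A greedy set containing a vanishing coefficient captures the whole expansion, so from here on the threshold is positive.\<close>
    define t where "t = Min ((\<lambda>j. cmod (c j)) ` \<Lambda>)"
    have t_le: "t \<le> cmod (c j)" if "j \<in> \<Lambda>" for j
      using that \<Lambda>(1) by (simp add: t_def)
    have "t \<in> (\<lambda>j. cmod (c j)) ` \<Lambda>" using \<Lambda>(1) False unfolding t_def by (intro Min_in) auto
    then have t: "t > 0" "\<And>j. j \<notin> \<Lambda> \<Longrightarrow> cmod (c j) \<le> t" using False \<Lambda>(2) by auto
    define R where "R = norm f"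
    have R: "0 \<le> R" "R \<le> K * R" using Kf by (auto simp: R_def)
    obtain n where n: "4 * K * R / t < 2 ^ n" using real_arch_pow[of 2 "4 * K * R / t"] by auto
    define m where "m = (LEAST k. 4 * K * R / t < 2 ^ k)"
    have m: "4 * K * R < t * 2 ^ m"
      using LeastI[of "\<lambda>k. 4 * K * R / t < 2 ^ k", OF n] t by (simp add: m_def field_simps)
    have m': "t * 2 ^ k \<le> 4 * K * R" if "k < m" for k
      using not_less_Least[of k "\<lambda>k. 4 * K * R / t < 2 ^ k"] that t by (simp add: m_def field_simps)
    define I where "I = {..<block_start m}"
    have "norm (\<Sum>j\<in>I - \<Lambda>. c j *\<^sub>C psi j) \<le> 4 * (4 * K * R)"
      by (rule norm_small_coefficients_le[of _ m t])
        (use t m' R K_ge_1 in \<open>auto simp: I_def\<close>)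
    moreover have "norm (\<Sum>j\<in>\<Lambda> - I. c j *\<^sub>C psi j) \<le> 3 * R"
    proof (rule norm_large_coefficients_le[of _ t c "deviation f" m])
      fix j assume j: "j \<in> \<Lambda> - I"
      then show lev: "m \<le> level j" by (simp add: I_def not_less flip: level_less_iff)
      have "cmod (c j - deviation f j) = cmod (coefficients x (fst f) (level j)) / 2 ^ level j"
        by (simp add: c_def deviation_def norm_divide norm_power)
      also have "\<dots> \<le> 2 * K * R / 2 ^ m"
        using norm_fst_coefficient_le[of f "level j"] lev K_ge_1 R by (intro frac_le) (auto simp: R_def)
      also have "\<dots> \<le> t / 2" using m by (simp add: field_simps)
      finally show "t \<le> cmod (c j) \<and> cmod (c j - deviation f j) \<le> t / 2"
        using j t_le by simp
    qed (use \<Lambda>(1) t R m sum_norm_squared_deviation_le[of "\<Lambda> - I" f] in \<open>auto simp: R_def\<close>)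
    moreover have "norm (\<Sum>j\<in>I. c j *\<^sub>C psi j) \<le> K * R"
      using norm_initial_le[of m f] by (simp add: initial_def I_def c_def R_def)
    moreover have "basis_projection psi \<Lambda> f
        = (\<Sum>j\<in>I. c j *\<^sub>C psi j) - (\<Sum>j\<in>I - \<Lambda>. c j *\<^sub>C psi j) + (\<Sum>j\<in>\<Lambda> - I. c j *\<^sub>C psi j)"
      using sum.Int_Diff[of I "\<lambda>j. c j *\<^sub>C psi j" \<Lambda>] sum.Int_Diff[of \<Lambda> "\<lambda>j. c j *\<^sub>C psi j" I] \<Lambda>(1)
      by (simp add: proj I_def Int_commute)
    ultimately have "norm (basis_projection psi \<Lambda> f) \<le> K * R + 4 * (4 * K * R) + 3 * R"
      by (smt (verit) norm_triangle_ineq norm_triangle_ineq4)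
    then show ?thesis using R by (simp add: R_def)
  qed
qed

lemma quasi_greedy_psi: "quasi_greedy psi"
  by (rule quasi_greedyI[OF normalized_psi norm_greedy_sum_le])

section \<open>Democracy\<close>

text \<open>With \<open>4 ^ m\<close> comparable to the number of elements, full blocks contribute at most
\<open>2 ^ k\<close> for \<open>k < m\<close>, and the blocks from \<open>m\<close> on together at most the number of elements times
\<open>2 ^ (- m)\<close>.\<close>

lemma norm_sum_psi_le:
  assumes "finite A"
  shows "norm (\<Sum>j\<in>A. psi j) \<le> 4 * sqrt (card A)"
proof (cases "A = {}")
  case False
  then have "card A \<ge> 1" using assms by (simp add: Suc_le_eq card_gt_0_iff)
  then obtain m where m: "card A \<le> 4 ^ m" "m = 0 \<or> 4 ^ (m - 1) < card A" by (rule power4_bracket)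
  define s where "s = sqrt (card A)"
  have s: "s * s = card A" "s \<ge> 1" using \<open>card A \<ge> 1\<close> by (auto simp: s_def)
  have "real (card A) \<le> 2 ^ m * 2 ^ m"
    unfolding power4_eq[symmetric] using of_nat_mono[OF m(1), where 'a = real] by simp
  then have up: "s \<le> 2 ^ m" unfolding s_def by (intro real_le_lsqrt) (auto simp: power2_eq_square)
  have low: "2 ^ m \<le> 2 * s"
  proof (cases "m = 0")
    case False
    then obtain k where k: "m = Suc k" by (cases m) auto
    then have "real (4 ^ k) \<le> card A" using m(2) by (intro of_nat_mono) simp
    then have "2 ^ k \<le> s" unfolding s_def by (intro real_le_rsqrt) (simp add: power4_eq power2_eq_square)
    then show ?thesis by (simp add: k)
  qed (use s in simp)
  have "(\<Sum>k\<in>level ` A. cmod (\<Sum>j\<in>A \<inter> block k. 1) / 2 ^ k)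
      \<le> (\<Sum>k<m. 2 ^ k) + (\<Sum>k\<in>level ` A. real (card (A \<inter> block k)) / 2 ^ m)"
  proof (rule sum_split_le)
    fix k assume "m \<le> k"
    then show "cmod (\<Sum>j\<in>A \<inter> block k. 1) / 2 ^ k \<le> real (card (A \<inter> block k)) / 2 ^ m"
      by (simp add: frac_le)
  next
    fix k
    show "cmod (\<Sum>j\<in>A \<inter> block k. 1) / 2 ^ k \<le> 2 ^ k"
      using card_inter_block_le[of A k] by (simp add: power4_eq divide_le_eq)
  qed (use assms in auto)
  also have "(\<Sum>k<m. 2 ^ k :: real) \<le> 2 ^ m" by (induction m) auto
  also have "(\<Sum>k\<in>level ` A. real (card (A \<inter> block k)) / 2 ^ m) = s * s / 2 ^ m"
    using sum_card_levels[OF assms] by (simp add: s flip: sum_divide_distrib)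
  also have "\<dots> \<le> s" using mult_left_mono[OF up, of s] s(2) by (simp add: divide_le_eq)
  finally have "(\<Sum>k\<in>level ` A. cmod (\<Sum>j\<in>A \<inter> block k. 1) / 2 ^ k) \<le> 3 * s" using low by simp
  then show ?thesis
    using norm_combination_le[of A "level ` A" "\<lambda>_. 1"] assms by (simp add: s_def)
qed simp

text \<open>By Pythagoras the number of elements is the squared \<open>\<ell>\<^sup>2\<close>-norm of the deviation plus the sum of
the squares of the \<open>X\<close>-coefficients \<open>b k\<close>. Blocks that are at most half full give at most half of the
number of elements, and the levels \<open>k\<close> of the others satisfy \<open>2 ^ k \<le> 2 * b k\<close>, so that their
squares form a geometric series bounded by a multiple of the squared norm.\<close>

lemma sqrt_card_le_norm_sum_psi:
  assumes "finite A"
  shows "sqrt (card A) \<le> 9 * K * norm (\<Sum>j\<in>A. psi j)"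
proof -
  define f where "f = (\<Sum>j\<in>A. psi j)"
  define c where "c = expansion f"
  define b where "b = (\<lambda>k. real (card (A \<inter> block k)) / 2 ^ k)"
  define R where "R = norm f"
  have "c = (\<lambda>j. if j \<in> A then 1 else 0)"
    using coefficients_finite_sum[OF schauder_psi assms, of "\<lambda>_. 1"]
    by (simp add: c_def f_def coefficients_psi)
  then have sums: "(\<Sum>j\<in>block k. c j) = card (A \<inter> block k)"
    "(\<Sum>j\<in>block k. (cmod (c j))\<^sup>2) = card (A \<inter> block k)" for k
    by (simp_all add: if_distrib[of cmod] if_distrib[of "\<lambda>x. x\<^sup>2"] Int_commute
        flip: sum.inter_restrict cong: if_cong)
  then have bal: "cmod (balance c k) = b k" for k by (simp add: balance_def b_def norm_divide norm_power)
  have b_le: "b k \<le> 2 * K * R" for k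
    using norm_fst_coefficient_le[of f k] bal[of k] by (simp add: c_def balance_expansion R_def)
  have b_le': "b k \<le> 2 ^ k" for k
    using card_inter_block_le[of A k] by (simp add: b_def power4_eq divide_le_eq)
  obtain m where m: "A \<subseteq> {..<block_start m}" using finite_first_blocks[OF assms] .
  have card: "(\<Sum>k<m. real (card (A \<inter> block k))) = card A"
  proof -
    have "level ` A \<subseteq> {..<m}" using m by (auto simp: level_less_iff)
    then show ?thesis using sum_over_levels[of A "{..<m}" "\<lambda>_. 1 :: real"] assms by simp
  qed
  have "(\<Sum>k<m. real (card (A \<inter> block k)) - (b k)\<^sup>2) = (\<Sum>j<block_start m. (cmod (deviation f j))\<^sup>2)"
    unfolding sum_over_first_blocks
  proof (rule sum.cong[OF refl])
    fix k
    have "(\<Sum>j\<in>block k. (cmod (deviation f j))\<^sup>2)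
        = (\<Sum>j\<in>block k. (cmod (c j - balance c k / 2 ^ k))\<^sup>2)"
      by (intro sum.cong) (auto simp: deviation_def c_def balance_expansion)
    then show "real (card (A \<inter> block k)) - (b k)\<^sup>2 = (\<Sum>j\<in>block k. (cmod (deviation f j))\<^sup>2)"
      by (simp add: sum_norm_squared_deviation sums bal)
  qed
  also have "\<dots> \<le> R\<^sup>2" unfolding R_def by (rule sum_norm_squared_deviation_le) simp
  finally have 1: "card A \<le> R\<^sup>2 + (\<Sum>k<m. (b k)\<^sup>2)" by (simp add: sum_subtractf card)
  \<comment> \<open>Levels of blocks that may be more than half full: there 2 ^ k is at most 2 * b k, hence at most 4 * K * R.\<close>
  define F where "F = {k. k < m \<and> 2 ^ k \<le> 4 * K * R}"
  have "(b k)\<^sup>2 \<le> real (card (A \<inter> block k)) / 2 + (if k \<in> F then 4 * K * R * 2 ^ k else 0)"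
    if "k < m" for k
  proof (cases "b k \<le> 2 ^ k / 2")
    case True
    have "(b k)\<^sup>2 \<le> b k * (2 ^ k / 2)"
      using True unfolding power2_eq_square by (intro mult_left_mono) (auto simp: b_def)
    also have "\<dots> = real (card (A \<inter> block k)) / 2" by (simp add: b_def)
    finally show ?thesis using K_ge_1 by (simp add: R_def add_increasing2)
  next
    case False
    then have "2 ^ k \<le> 4 * K * R" using b_le[of k] by simp
    then have "k \<in> F" "b k \<le> 4 * K * R" using that b_le'[of k] by (auto simp: F_def)
    moreover have "b k * b k \<le> 4 * K * R * 2 ^ k"
      using \<open>b k \<le> 4 * K * R\<close> b_le'[of k] K_ge_1 by (intro mult_mono) (auto simp: R_def b_def)
    ultimately show ?thesis by (simp add: power2_eq_square)
  qed
  then have "(\<Sum>k<m. (b k)\<^sup>2)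
      \<le> (\<Sum>k<m. real (card (A \<inter> block k)) / 2 + (if k \<in> F then 4 * K * R * 2 ^ k else 0))"
    by (intro sum_mono) auto
  also have "\<dots> = card A / 2 + 4 * K * R * (\<Sum>k\<in>F. 2 ^ k)"
  proof -
    have "{..<m} \<inter> F = F" by (auto simp: F_def)
    then show ?thesis
      using card by (simp add: sum.distrib sum_distrib_left flip: sum_divide_distrib sum.inter_restrict)
  qed
  also have "(\<Sum>k\<in>F. 2 ^ k) \<le> 2 * (4 * K * R)"
    using K_ge_1 by (intro sum_powers_of_2_le) (auto simp: F_def R_def)
  finally have "(\<Sum>k<m. (b k)\<^sup>2) \<le> card A / 2 + 4 * K * R * (2 * (4 * K * R))"
    using K_ge_1 by (simp add: R_def mult_left_mono)
  with 1 have "card A \<le> 2 * R\<^sup>2 + 64 * (K * R)\<^sup>2" by (simp add: power2_eq_square)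
  also have "R\<^sup>2 \<le> (K * R)\<^sup>2"
    using K_ge_1 mult_right_mono[of 1 K R] by (intro power_mono) (auto simp: R_def)
  finally have "card A \<le> 66 * (K * R)\<^sup>2" by simp
  also have "\<dots> \<le> 81 * (K * R)\<^sup>2" by (intro mult_right_mono) auto
  also have "\<dots> = (9 * K * R)\<^sup>2" by (simp add: power_mult_distrib)
  finally show ?thesis using K_ge_1 by (intro real_le_lsqrt) (auto simp: R_def f_def)
qed

lemma democratic_psi: "democratic psi"
  unfolding democratic_def
proof (intro exI allI impI)
  fix A B :: "nat set" assume "finite A" "finite B" "card A = card B"
  then show "norm (\<Sum>j\<in>A. psi j) \<le> (36 * K) * norm (\<Sum>j\<in>B. psi j)"
    using norm_sum_psi_le[of A] sqrt_card_le_norm_sum_psi[of B] by simp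
qed

section \<open>Conditionality\<close>

text \<open>The deviation and the constant parts of the coefficients are projected separately. In both, each of
the first \<open>m\<close> blocks contributes at most a multiple of \<open>norm f\<close>, and the later blocks together do
too, because the set has at most \<open>4 ^ m\<close> elements.\<close>

lemma norm_projection_le:
  assumes A: "finite A" "card A \<le> 4 ^ m"
  shows "norm (basis_projection psi A f) \<le> 6 * K * (real m + 1) * norm f"
proof -
  define R where "R = norm f"
  define M where "M = 2 * K * R"
  define d where "d = deviation f"
  define \<beta> where "\<beta> = (\<lambda>j. coefficients x (fst f) (level j) / 2 ^ level j)"
  have R: "0 \<le> R" "0 \<le> M" "R \<le> K * R"
    using K_ge_1 mult_right_mono[of 1 K R] by (auto simp: R_def M_def)
  have card: "real (card A) \<le> 4 ^ m" using of_nat_mono[OF A(2), where 'a = real] by simp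
  have l2: "sqrt (\<Sum>j\<in>B. (cmod (d j))\<^sup>2) \<le> R" if "finite B" for B
    using sum_norm_squared_deviation_le[OF that, of f] by (intro real_le_lsqrt) (auto simp: d_def R_def)
  have "(\<Sum>k\<in>level ` A. cmod (\<Sum>j\<in>A \<inter> block k. d j) / 2 ^ k)
      \<le> (\<Sum>k<m. R) + (\<Sum>k\<in>level ` A. \<Sum>j\<in>A \<inter> block k. cmod (d j) / 2 ^ m)"
  proof (rule sum_split_le)
    fix k
    show "cmod (\<Sum>j\<in>A \<inter> block k. d j) / 2 ^ k \<le> R"
      using norm_sum_block_le[of "A \<inter> block k" k d] l2[of "A \<inter> block k"] by simp
  next
    fix k assume "m \<le> k"
    have "cmod (\<Sum>j\<in>A \<inter> block k. d j) / 2 ^ k \<le> (\<Sum>j\<in>A \<inter> block k. cmod (d j)) / 2 ^ m"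
      using \<open>m \<le> k\<close> by (intro frac_le norm_sum sum_nonneg) auto
    then show "cmod (\<Sum>j\<in>A \<inter> block k. d j) / 2 ^ k \<le> (\<Sum>j\<in>A \<inter> block k. cmod (d j) / 2 ^ m)"
      by (simp add: sum_divide_distrib)
  qed (use A R in \<open>auto intro: sum_nonneg\<close>)
  also have "(\<Sum>k\<in>level ` A. \<Sum>j\<in>A \<inter> block k. cmod (d j) / 2 ^ m) = (\<Sum>j\<in>A. cmod (d j)) / 2 ^ m"
    unfolding sum_divide_distrib using A by (intro sum_over_levels) auto
  also have "\<dots> \<le> R"
  proof -
    have "sqrt (card A) \<le> 2 ^ m"
      using card by (intro real_le_lsqrt) (auto simp: power4_eq power2_eq_square)
    then have "sqrt (card A) * sqrt (\<Sum>j\<in>A. (cmod (d j))\<^sup>2) \<le> 2 ^ m * R"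
      using l2[OF A(1)] by (intro mult_mono) (auto intro: sum_nonneg)
    then show ?thesis using sum_norm_le_sqrt_card[of d A] by (simp add: divide_le_eq mult.commute)
  qed
  finally have "norm (\<Sum>j\<in>A. d j *\<^sub>C psi j) \<le> real m * R + R + R"
    using norm_combination_le[OF A(1) finite_imageI[OF A(1)] order_refl, of d] l2[OF A(1)] by simp
  moreover have "norm (\<Sum>j\<in>A. \<beta> j *\<^sub>C psi j) \<le> 2 * (M * (real m + 1))"
  proof -
    have \<beta>: "cmod (\<beta> j) \<le> M / 2 ^ level j" for j
      using norm_fst_coefficient_le[of f "level j"]
      by (simp add: \<beta>_def norm_divide norm_power divide_right_mono M_def R_def)
    \<comment> \<open>Each of the first m blocks contributes at most 1, and all later ones together at most card A / 4 ^ m.\<close>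
    have w: "(\<Sum>k\<in>level ` A. real (card (A \<inter> block k)) / 4 ^ k) \<le> real m + 1"
    proof -
      have "(\<Sum>k\<in>level ` A. real (card (A \<inter> block k)) / 4 ^ k)
          \<le> (\<Sum>k<m. 1) + (\<Sum>k\<in>level ` A. real (card (A \<inter> block k)) / 4 ^ m)"
      proof (rule sum_split_le)
        fix k assume "m \<le> k"
        then show "real (card (A \<inter> block k)) / 4 ^ k \<le> real (card (A \<inter> block k)) / 4 ^ m"
          by (intro frac_le) auto
      qed (use A card_inter_block_le in \<open>auto simp: divide_le_eq\<close>)
      also have "(\<Sum>k\<in>level ` A. real (card (A \<inter> block k)) / 4 ^ m) \<le> 1"
        using sum_card_levels[OF A(1)] card by (simp add: divide_le_eq flip: sum_divide_distrib)
      finally show ?thesis by simp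
    qed
    have "(\<Sum>k\<in>level ` A. cmod (\<Sum>j\<in>A \<inter> block k. \<beta> j) / 2 ^ k)
        \<le> (\<Sum>k\<in>level ` A. M * (real (card (A \<inter> block k)) / 4 ^ k))"
    proof (rule sum_mono)
      fix k
      have "cmod (\<Sum>j\<in>A \<inter> block k. \<beta> j) \<le> (\<Sum>j\<in>A \<inter> block k. M / 2 ^ k)"
        by (rule sum_norm_le) (use \<beta> in auto)
      then show "cmod (\<Sum>j\<in>A \<inter> block k. \<beta> j) / 2 ^ k \<le> M * (real (card (A \<inter> block k)) / 4 ^ k)"
        by (simp add: power4_eq field_simps)
    qed
    also have "\<dots> \<le> M * (real m + 1)"
      unfolding sum_distrib_left[symmetric] using w R by (intro mult_left_mono) auto
    finally have 1: "(\<Sum>k\<in>level ` A. cmod (\<Sum>j\<in>A \<inter> block k. \<beta> j) / 2 ^ k) \<le> M * (real m + 1)" .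
    have "(\<Sum>j\<in>A. (cmod (\<beta> j))\<^sup>2) \<le> (\<Sum>j\<in>A. M\<^sup>2 / 4 ^ level j)"
      using power_mono[OF \<beta>, of _ 2] by (intro sum_mono) (simp add: power_divide power4_eq power2_eq_square)
    also have "\<dots> = (\<Sum>k\<in>level ` A. \<Sum>j\<in>A \<inter> block k. M\<^sup>2 / 4 ^ level j)"
      using A by (intro sum_over_levels[symmetric]) auto
    also have "\<dots> = (\<Sum>k\<in>level ` A. M\<^sup>2 * (real (card (A \<inter> block k)) / 4 ^ k))"
      by (intro sum.cong) auto
    also have "\<dots> \<le> M\<^sup>2 * (real m + 1)"
      unfolding sum_distrib_left[symmetric] using w by (intro mult_left_mono) auto
    also have "\<dots> \<le> M\<^sup>2 * ((real m + 1) * (real m + 1))" by (intro mult_left_mono) auto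
    also have "\<dots> = (M * (real m + 1))\<^sup>2" by (simp add: power2_eq_square)
    finally have 2: "sqrt (\<Sum>j\<in>A. (cmod (\<beta> j))\<^sup>2) \<le> M * (real m + 1)"
      using R by (intro real_le_lsqrt) auto
    show ?thesis
      using norm_combination_le[OF A(1) finite_imageI[OF A(1)] order_refl, of \<beta>] 1 2 by simp
  qed
  moreover have "basis_projection psi A f = (\<Sum>j\<in>A. d j *\<^sub>C psi j) + (\<Sum>j\<in>A. \<beta> j *\<^sub>C psi j)"
    by (simp add: basis_projection_def coefficients_psi d_def \<beta>_def deviation_def
        flip: sum.distrib scaleC_add_left)
  ultimately have "norm (basis_projection psi A f) \<le> real m * R + R + R + 2 * (M * (real m + 1))"
    by (smt (verit) norm_triangle_ineq)
  also have "\<dots> \<le> 2 * (real m + 1) * R + 4 * (real m + 1) * (K * R)"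
    using R by (simp add: M_def algebra_simps)
  also have "\<dots> \<le> 2 * (real m + 1) * (K * R) + 4 * (real m + 1) * (K * R)"
    using R K_ge_1 by (intro add_mono mult_left_mono) auto
  finally show ?thesis by (simp add: R_def algebra_simps)
qed

lemma conditionality_psi_le:
  assumes "N \<ge> 2"
  shows "conditionality_constant psi N \<le> 15 * K / ln 2 * ln N"
proof -
  obtain m where m: "N \<le> 4 ^ m" "m = 0 \<or> 4 ^ (m - 1) < N" using power4_bracket[of N] assms by auto
  then obtain k where k: "m = Suc k" "4 ^ k < N" using assms by (cases m) auto
  have "conditionality_constant psi N \<le> 6 * K * (real m + 1)"
  proof (rule conditionality_constant_le)
    fix A :: "nat set" and f assume "finite A" "card A \<le> N"
    then show "norm (basis_projection psi A f) \<le> 6 * K * (real m + 1) * norm f"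
      using m(1) by (intro norm_projection_le) auto
  qed (use K_ge_1 in auto)
  also have "\<dots> \<le> 6 * K * (5 / 2 * (ln N / ln 2))"
  proof (rule mult_left_mono)
    have "real (4 ^ k) \<le> real N" using k(2) by (intro of_nat_mono) simp
    then have "ln (4 ^ k :: real) \<le> ln N" using assms by (subst ln_le_cancel_iff) auto
    moreover have "ln (4 ^ k :: real) = 2 * k * ln 2"
      using ln_realpow[of "2 :: real" 2] by (simp add: ln_realpow)
    moreover have "ln 2 \<le> ln N" using assms by simp
    ultimately have "(real m + 1) * ln 2 \<le> 5 / 2 * ln N" by (simp add: k algebra_simps)
    then show "real m + 1 \<le> 5 / 2 * (ln N / ln 2)" by (simp add: field_simps)
  qed (use K_ge_1 in auto)
  finally show ?thesis by simp
qed

text \<open>Projecting \<open>(z, 0)\<close> onto whole blocks acts on the first component like the coordinate projection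
in \<open>X\<close>.\<close>

lemma norm_projection_le_conditionality_psi:
  assumes "B \<subseteq> {..<n}" "z \<noteq> 0" "r * norm z \<le> norm (basis_projection x B z)" "block_start n \<le> N"
  shows "r \<le> conditionality_constant psi N"
proof -
  define A where "A = {j. level j \<in> B}"
  have A: "A \<subseteq> {..<block_start n}" using assms(1) by (auto simp: A_def simp flip: level_less_iff)
  then have fin: "finite A" "finite B" using assms(1) finite_subset by auto
  have "card A \<le> N" using card_mono[OF _ A] assms(4) by simp
  obtain m where m: "N \<le> 4 ^ m" using power4_bracket[of "Suc N"] by (metis Suc_leD le_add1 plus_1_eq_Suc)
  have AB: "A \<inter> block k = block k" if "k \<in> B" for k using that by (auto simp: A_def)
  have "fst (basis_projection psi A (z, 0)) = basis_projection x B z"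
    unfolding basis_projection_def coefficients_psi
  proof (subst fst_combination[OF fin], force simp: A_def, rule sum.cong[OF refl])
    fix k assume "k \<in> B"
    then show "((\<Sum>j\<in>A \<inter> block k. expansion (z, 0) j) / 2 ^ k) *\<^sub>C x k = coefficients x z k *\<^sub>C x k"
      using balance_expansion[of "(z, 0)" k] by (simp add: AB balance_def)
  qed
  then have "norm (basis_projection x B z) \<le> norm (basis_projection psi A (z, 0))"
    by (metis norm_fst_le prod.collapse)
  then have "r * norm (z, 0 :: ell2) \<le> norm (basis_projection psi A (z, 0))"
    using assms(3) by simp
  then show ?thesis
    by (intro le_conditionality_constant[OF _ _ fin(1) \<open>card A \<le> N\<close>, of _ "6 * K * (real m + 1)" "(z, 0)"]
        norm_projection_le) (use m assms(2) K_ge_1 in \<open>auto simp: zero_prod_def\<close>)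
qed

text \<open>The first \<open>n\<close> blocks have fewer than \<open>4 ^ n\<close> elements, so \<open>n\<close> may be taken comparable to \<open>ln N\<close>.\<close>

lemma le_conditionality_psi:
  assumes "c \<ge> 0" "N \<ge> 2"
    and lower: "\<And>n. \<exists>B z. B \<subseteq> {..<n} \<and> z \<noteq> 0 \<and> c * real n * norm z \<le> norm (basis_projection x B z)"
  shows "c / (4 * ln 2) * ln N \<le> conditionality_constant psi N"
proof -
  obtain m where m: "N \<le> 4 ^ m" "m = 0 \<or> 4 ^ (m - 1) < N" using power4_bracket[of N] assms by auto
  \<comment> \<open>For m = 1 the bound c * (m - 1) would be trivial; with the maximum, m is at most 2 * n in all cases.\<close>
  define n where "n = max 1 (m - 1)"
  have bs: "block_start k \<le> 4 ^ k" for k by (induction k) (auto simp: block_start_def)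
  have "block_start n \<le> N"
  proof (cases "m \<le> 2")
    case True
    then have "n = 1" by (auto simp: n_def)
    then show ?thesis using assms by (simp add: block_start_def)
  next
    case False
    then have "n = m - 1" by (simp add: n_def)
    then show ?thesis using False m bs[of "m - 1"] by simp
  qed
  moreover obtain B z where "B \<subseteq> {..<n}" "z \<noteq> 0" "c * real n * norm z \<le> norm (basis_projection x B z)"
    using lower by blast
  ultimately have "c * real n \<le> conditionality_constant psi N"
    by (intro norm_projection_le_conditionality_psi)
  moreover have "ln N \<le> 4 * ln 2 * real n"
  proof -
    have "real N \<le> real (4 ^ m)" using m(1) by (rule of_nat_mono)
    then have "ln N \<le> ln (4 ^ m :: real)" using assms by (subst ln_le_cancel_iff) auto
    also have "\<dots> = 2 * m * ln 2"
      using ln_realpow[of "2 :: real" 2] by (simp add: ln_realpow)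
    also have "\<dots> \<le> 2 * (2 * real n) * ln 2" by (intro mult_right_mono) (auto simp: n_def)
    finally show ?thesis by (simp add: mult_ac)
  qed
  then have "c / (4 * ln 2) * ln N \<le> c / (4 * ln 2) * (4 * ln 2 * real n)"
    using \<open>c \<ge> 0\<close> by (intro mult_left_mono) auto
  ultimately show ?thesis by simp
qed

end

section \<open>A conditional basis of the sum of c0 and l1\<close>

lemma c0_nth_zero [simp]: "c0_nth 0 n = 0"
  and c0_nth_add: "c0_nth (g + h) n = c0_nth g n + c0_nth h n"
  and c0_nth_scaleC: "c0_nth (c *\<^sub>C g) n = c * c0_nth g n"
  by (transfer; simp)+

lemma ell1_nth_zero [simp]: "ell1_nth 0 n = 0"
  and ell1_nth_add: "ell1_nth (g + h) n = ell1_nth g n + ell1_nth h n"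
  and ell1_nth_scaleC: "ell1_nth (c *\<^sub>C g) n = c * ell1_nth g n"
  by (transfer; simp)+

lemma bounded_linear_c0_nth: "bounded_linear (\<lambda>g. c0_nth g n)"
  by (rule bounded_linear_intro[where K = 1])
    (auto simp: c0_nth_add c0_nth_scaleC scaleR_scaleC scaleR_conv_of_real norm_c0_nth_le)

lemma bounded_linear_ell1_nth: "bounded_linear (\<lambda>g. ell1_nth g n)"
  by (rule bounded_linear_intro[where K = 1])
    (auto simp: ell1_nth_add ell1_nth_scaleC scaleR_scaleC scaleR_conv_of_real norm_ell1_nth_le)

definition summing :: "nat \<Rightarrow> c0" where
  "summing m = Abs_c0 (\<lambda>n. if n \<le> m then 1 else 0)"

lemma c0_nth_Abs_eventually_0:
  assumes "\<And>n. n > m \<Longrightarrow> a n = 0"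
  shows "c0_nth (Abs_c0 a) = a"
proof (rule Abs_c0_inverse, rule CollectI, rule tendsto_eventually)
  show "\<forall>\<^sub>F n in sequentially. a n = 0"
    using eventually_gt_at_top[of m] by eventually_elim (rule assms)
qed

lemma c0_nth_summing: "c0_nth (summing m) n = (if n \<le> m then 1 else 0)"
  unfolding summing_def by (subst c0_nth_Abs_eventually_0[of m]) auto

definition ell1_unit :: "nat \<Rightarrow> ell1" where
  "ell1_unit m = Abs_ell1 (\<lambda>n. if n = m then 1 else 0)"

lemma ell1_nth_unit: "ell1_nth (ell1_unit m) n = (if n = m then 1 else 0)"
proof -
  have "summable (\<lambda>n. cmod (if n = m then 1 else 0))"
    by (rule summable_finite[of "{m}"]) auto
  then show ?thesis by (simp add: ell1_unit_def Abs_ell1_inverse)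
qed

definition interleaved :: "nat \<Rightarrow> c0 \<times> ell1" where
  "interleaved j = (if even j then (summing (j div 2), 0) else (0, ell1_unit (j div 2)))"

definition interleaved_coord :: "c0 \<times> ell1 \<Rightarrow> nat \<Rightarrow> complex" where
  "interleaved_coord f j = (if even j then c0_nth (fst f) (j div 2) - c0_nth (fst f) (Suc (j div 2))
     else ell1_nth (snd f) (j div 2))"

lemma norm_interleaved: "norm (interleaved j) = 1"
proof -
  have "norm (summing m) = 1" for m
  proof (rule antisym)
    show "norm (summing m) \<le> 1" by (rule norm_c0_leI) (simp add: c0_nth_summing)
    show "1 \<le> norm (summing m)" using norm_c0_nth_le[of "summing m" 0] by (simp add: c0_nth_summing)
  qed
  moreover have "norm (ell1_unit m) = 1" for m
  proof (rule antisym)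
    show "norm (ell1_unit m) \<le> 1"
      unfolding norm_ell1_le_iff by (simp add: ell1_nth_unit if_distrib[of cmod] cong: if_cong)
    show "1 \<le> norm (ell1_unit m)" using norm_ell1_nth_le[of "ell1_unit m" m] by (simp add: ell1_nth_unit)
  qed
  ultimately show ?thesis by (simp add: interleaved_def norm_prod_def)
qed

lemma bounded_linear_interleaved_coord: "bounded_linear (\<lambda>f. interleaved_coord f j)"
  unfolding interleaved_coord_def
  by (cases "even j")
    (simp_all add: bounded_linear_sub bounded_linear_compose[OF bounded_linear_c0_nth bounded_linear_fst]
      bounded_linear_compose[OF bounded_linear_ell1_nth bounded_linear_snd])

lemma interleaved_coord_interleaved: "interleaved_coord (c *\<^sub>C interleaved j) i = (if i = j then c else 0)"
proof -
  have "j = i" if "even i" "even j" "i div 2 = j div 2" using that by (metis dvd_mult_div_cancel)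
  moreover have "j = i" if "odd i" "odd j" "i div 2 = j div 2" using that by (metis odd_two_times_div_two_succ)
  ultimately show ?thesis
    by (auto simp: interleaved_coord_def interleaved_def c0_nth_scaleC ell1_nth_scaleC c0_nth_summing ell1_nth_unit)
qed

text \<open>Of the first \<open>n\<close> indices, \<open>Suc n div 2\<close> are even and \<open>n div 2\<close> are odd.\<close>

lemma interleaved_partial_sum:
  "(\<Sum>j<n. interleaved_coord f j *\<^sub>C interleaved j)
    = (\<Sum>m<Suc n div 2. interleaved_coord f (2 * m) *\<^sub>C summing m,
       \<Sum>m<n div 2. interleaved_coord f (Suc (2 * m)) *\<^sub>C ell1_unit m)"
proof (induction n)
  case (Suc n)
  show ?case
  proof (cases "even n")
    case True
    then obtain k where k: "n = 2 * k" by blast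
    then have "interleaved_coord f n *\<^sub>C interleaved n = (interleaved_coord f (2 * k) *\<^sub>C summing k, 0)"
      by (simp add: interleaved_def scaleC_prod_def)
    then show ?thesis unfolding sum.lessThan_Suc[of _ n] Suc by (simp add: k)
  next
    case False
    then obtain k where k: "n = Suc (2 * k)" by (metis oddE Suc_eq_plus1)
    then have "interleaved_coord f n *\<^sub>C interleaved n = (0, interleaved_coord f (Suc (2 * k)) *\<^sub>C ell1_unit k)"
      by (simp add: interleaved_def scaleC_prod_def)
    then show ?thesis unfolding sum.lessThan_Suc[of _ n] Suc by (simp add: k)
  qed
qed (simp add: zero_prod_def)

text \<open>The differences of consecutive entries telescope.\<close>

lemma c0_nth_partial_sum:
  "c0_nth (\<Sum>m<M. interleaved_coord f (2 * m) *\<^sub>C summing m) i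
    = (if i < M then c0_nth (fst f) i - c0_nth (fst f) M else 0)"
proof (induction M)
  case (Suc M)
  then show ?case
    by (cases "i = M") (auto simp: c0_nth_add c0_nth_scaleC c0_nth_summing interleaved_coord_def)
qed simp

lemma ell1_nth_partial_sum:
  "ell1_nth (\<Sum>m<M. interleaved_coord f (Suc (2 * m)) *\<^sub>C ell1_unit m) i
    = (if i < M then ell1_nth (snd f) i else 0)"
  by (induction M) (auto simp: ell1_nth_add ell1_nth_scaleC ell1_nth_unit interleaved_coord_def less_Suc_eq)

lemma ell1_dominated_convergence:
  assumes lim: "\<And>n. (\<lambda>m. ell1_nth (G m) n) \<longlonglongrightarrow> ell1_nth g n"
    and dom: "\<And>m n. cmod (ell1_nth (G m) n - ell1_nth g n) \<le> cmod (ell1_nth g n)"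
  shows "G \<longlonglongrightarrow> g"
proof -
  let ?h = "\<lambda>n m. cmod (ell1_nth (G m) n - ell1_nth g n)"
  have "(\<lambda>m. \<Sum>n. ?h n m) \<longlonglongrightarrow> (\<Sum>n. 0)"
  proof (intro conjunct2[OF conjunct2[OF tannerys_theorem]])
    show "summable (\<lambda>n. cmod (ell1_nth g n))" using ell1_nth by blast
    show "(\<lambda>m. ?h n m) \<longlonglongrightarrow> 0" for n
      using tendsto_norm[OF LIM_zero[OF lim[of n]]] by simp
    show "\<forall>\<^sub>F (n, m) in sequentially \<times>\<^sub>F sequentially. norm (?h n m) \<le> cmod (ell1_nth g n)"
      by (rule always_eventually) (auto intro!: dom)
  qed simp
  moreover have "norm (G m - g) = (\<Sum>n. ?h n m)" for m
    unfolding ell1_nth_minus[symmetric] by transfer simp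
  ultimately have "(\<lambda>m. norm (G m - g)) \<longlonglongrightarrow> 0" by simp
  then show ?thesis by (rule Lim_null[THEN iffD2, OF tendsto_norm_zero_cancel])
qed

text \<open>In \<open>c\<^sub>0\<close> the error of a partial sum of length \<open>M\<close> has, up to sign, only entries of the sequence from
the \<open>M\<close>-th one on, which are uniformly small. In \<open>\<ell>\<^sup>1\<close> dominated convergence applies.\<close>

lemma interleaved_coord_sums: "(\<lambda>j. interleaved_coord f j *\<^sub>C interleaved j) sums f"
proof -
  have 1: "(\<lambda>M. \<Sum>m<M. interleaved_coord f (2 * m) *\<^sub>C summing m) \<longlonglongrightarrow> fst f"
  proof (rule LIMSEQ_I)
    fix \<epsilon> :: real assume "\<epsilon> > 0"
    have "c0_nth (fst f) \<longlonglongrightarrow> 0" using c0_nth by blast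
    then obtain M0 where M0: "\<And>n. n \<ge> M0 \<Longrightarrow> cmod (c0_nth (fst f) n) < \<epsilon> / 2"
      using LIMSEQ_D[of "c0_nth (fst f)" 0 "\<epsilon> / 2"] \<open>\<epsilon> > 0\<close> by auto
    show "\<exists>no. \<forall>M\<ge>no. norm ((\<Sum>m<M. interleaved_coord f (2 * m) *\<^sub>C summing m) - fst f) < \<epsilon>"
    proof (intro exI allI impI)
      fix M assume "M \<ge> M0"
      have "norm ((\<Sum>m<M. interleaved_coord f (2 * m) *\<^sub>C summing m) - fst f) \<le> \<epsilon> / 2"
        using M0 \<open>M \<ge> M0\<close>
        by (intro norm_c0_leI) (auto simp: c0_nth_minus c0_nth_partial_sum intro: less_imp_le)
      then show "norm ((\<Sum>m<M. interleaved_coord f (2 * m) *\<^sub>C summing m) - fst f) < \<epsilon>"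
        using \<open>\<epsilon> > 0\<close> by simp
    qed
  qed
  have 2: "(\<lambda>M. \<Sum>m<M. interleaved_coord f (Suc (2 * m)) *\<^sub>C ell1_unit m) \<longlonglongrightarrow> snd f"
  proof (rule ell1_dominated_convergence)
    fix n
    have "\<forall>\<^sub>F M in sequentially. ell1_nth (snd f) n
        = ell1_nth (\<Sum>m<M. interleaved_coord f (Suc (2 * m)) *\<^sub>C ell1_unit m) n"
      using eventually_gt_at_top[of n] by eventually_elim (simp add: ell1_nth_partial_sum)
    then show "(\<lambda>M. ell1_nth (\<Sum>m<M. interleaved_coord f (Suc (2 * m)) *\<^sub>C ell1_unit m) n)
        \<longlonglongrightarrow> ell1_nth (snd f) n"
      by (rule Lim_transform_eventually[OF tendsto_const])
  qed (simp add: ell1_nth_partial_sum)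
  have half: "filterlim (\<lambda>n. n div 2) at_top sequentially"
    unfolding filterlim_at_top
  proof
    fix m :: nat
    show "\<forall>\<^sub>F n in sequentially. m \<le> n div 2"
      using eventually_ge_at_top[of "2 * m"] by eventually_elim linarith
  qed
  have half': "filterlim (\<lambda>n. Suc n div 2) at_top sequentially"
    by (rule filterlim_compose[OF half filterlim_Suc])
  have "(\<lambda>n. \<Sum>j<n. interleaved_coord f j *\<^sub>C interleaved j) \<longlonglongrightarrow> (fst f, snd f)"
    unfolding interleaved_partial_sum
    by (rule tendsto_Pair[OF filterlim_compose[OF 1 half'] filterlim_compose[OF 2 half]])
  then show ?thesis by (simp add: sums_def)
qed

lemma interleaved_coord_unique:
  assumes "(\<lambda>j. a j *\<^sub>C interleaved j) sums f"
  shows "a = interleaved_coord f"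
proof
  fix i
  have "(\<lambda>j. interleaved_coord (a j *\<^sub>C interleaved j) i) sums interleaved_coord f i"
    by (rule bounded_linear.sums[OF bounded_linear_interleaved_coord assms])
  moreover have "(\<lambda>j. interleaved_coord (a j *\<^sub>C interleaved j) i) sums a i"
    using sums_single[of i a] by (simp add: interleaved_coord_interleaved eq_commute cong: if_cong)
  ultimately show "a i = interleaved_coord f i" by (rule sums_unique2[symmetric])
qed

lemma normalized_interleaved: "normalized_basis interleaved"
  unfolding normalized_basis_def schauder_basis_def
  using interleaved_coord_sums interleaved_coord_unique norm_interleaved by blast

lemma coefficients_interleaved: "coefficients interleaved f = interleaved_coord f"
  using normalized_interleaved by (intro coefficients_eqI interleaved_coord_sums) (simp add: normalized_basis_def)

lemma norm_interleaved_partial_sum_le: "norm (basis_projection interleaved {..<n} f) \<le> 2 * norm f"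
proof -
  let ?y = "\<lambda>M. \<Sum>m<M. interleaved_coord f (2 * m) *\<^sub>C summing m"
  let ?w = "\<lambda>M. \<Sum>m<M. interleaved_coord f (Suc (2 * m)) *\<^sub>C ell1_unit m"
  have 1: "norm (?y M) \<le> 2 * norm (fst f)" for M
  proof (rule norm_c0_leI)
    fix i
    have "cmod (c0_nth (fst f) i - c0_nth (fst f) M) \<le> norm (fst f) + norm (fst f)"
      by (intro order_trans[OF norm_triangle_ineq4] add_mono norm_c0_nth_le)
    then show "cmod (c0_nth (?y M) i) \<le> 2 * norm (fst f)" by (simp add: c0_nth_partial_sum)
  qed
  have 2: "norm (?w M) \<le> norm (snd f)" for M
    unfolding norm_ell1_le_iff
  proof
    fix n
    have "(\<Sum>i<n. cmod (ell1_nth (?w M) i)) \<le> (\<Sum>i<n. cmod (ell1_nth (snd f) i))"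
      by (intro sum_mono) (simp add: ell1_nth_partial_sum)
    also have "\<dots> \<le> norm (snd f)" using norm_ell1_le_iff[of "snd f" "norm (snd f)"] by simp
    finally show "(\<Sum>i<n. cmod (ell1_nth (?w M) i)) \<le> norm (snd f)" .
  qed
  have "norm (basis_projection interleaved {..<n} f)
      \<le> sqrt ((2 * norm (fst f))\<^sup>2 + (2 * norm (snd f))\<^sup>2)"
    unfolding basis_projection_def coefficients_interleaved interleaved_partial_sum norm_Pair
    using order_trans[OF 2, of "2 * norm (snd f)"]
    by (intro real_sqrt_le_mono add_mono power_mono 1) auto
  also have "\<dots> = 2 * norm f"
    unfolding norm_prod_def power_mult_distrib distrib_left[symmetric] real_sqrt_mult by simp
  finally show ?thesis .
qed

text \<open>The summing-basis coefficients of the indicator of the odd numbers alternate between \<open>-1\<close> and \<open>1\<close>.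
Projecting onto every second of them, that is, onto every fourth index of the interleaved basis, leaves
coefficients of one sign, which add up in the zeroth entry.\<close>

lemma interleaved_conditional:
  "\<exists>B z. B \<subseteq> {..<n} \<and> z \<noteq> 0 \<and> 1 / 4 * real n * norm z \<le> norm (basis_projection interleaved B z)"
proof -
  \<comment> \<open>The cut-off at 2 * n + 2 keeps the sequence nonzero for n = 0.\<close>
  define y where "y = Abs_c0 (\<lambda>i. if odd i \<and> i < 2 * n + 2 then 1 else 0)"
  have y: "c0_nth y i = (if odd i \<and> i < 2 * n + 2 then 1 else 0)" for i
    unfolding y_def by (subst c0_nth_Abs_eventually_0[of "2 * n + 2"]) auto
  define z :: "c0 \<times> ell1" where "z = (y, 0)"
  define B where "B = (\<lambda>i. 4 * i) ` {..<(n + 3) div 4}"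
  have B: "B \<subseteq> {..<n}" by (auto simp: B_def)
  have "c0_nth y 1 \<noteq> c0_nth 0 1" unfolding y by simp
  then have "z \<noteq> 0" by (auto simp: z_def zero_prod_def)
  have "norm y \<le> 1" by (rule norm_c0_leI) (simp add: y)
  then have "norm z \<le> 1" by (simp add: z_def)
  have coord: "interleaved_coord z k *\<^sub>C interleaved k = (- summing (k div 2), 0)" if "k \<in> B" for k
  proof -
    obtain i where i: "k = 4 * i" using \<open>k \<in> B\<close> unfolding B_def by blast
    moreover have "k < n" using that B by auto
    ultimately show ?thesis
      by (simp add: interleaved_coord_def z_def y interleaved_def scaleC_prod_def scaleC_minus_left)
  qed
  have "c0_nth (\<Sum>k\<in>B. - summing (k div 2)) 0 = (\<Sum>k\<in>B. c0_nth (- summing (k div 2)) 0)"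
    by (rule bounded_linear.linear[OF bounded_linear_c0_nth, THEN linear_sum])
  also have "\<dots> = - of_nat (card B)"
    using bounded_linear.linear[OF bounded_linear_c0_nth, THEN linear_neg]
    by (simp add: c0_nth_summing)
  finally have "real (card B) \<le> norm (\<Sum>k\<in>B. - summing (k div 2))"
    by (metis norm_c0_nth_le norm_minus_cancel norm_of_nat)
  moreover have "basis_projection interleaved B z = (\<Sum>k\<in>B. - summing (k div 2), 0)"
    unfolding basis_projection_def coefficients_interleaved
    using coord by (simp add: sum_prod)
  moreover have "real n \<le> 4 * real (card B)"
  proof -
    have "card B = (n + 3) div 4" by (simp add: B_def card_image inj_on_def)
    then show ?thesis by linarith
  qed
  moreover have "real n * norm z \<le> real n * 1" using \<open>norm z \<le> 1\<close> by (intro mult_left_mono) auto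
  ultimately have "1 / 4 * real n * norm z \<le> norm (basis_projection interleaved B z)" by simp
  with B \<open>z \<noteq> 0\<close> show ?thesis by blast
qed

section \<open>The basis of the triple sum\<close>

lemma isometric_isomorphism_assoc:
  "isometric_isomorphism (\<lambda>f :: ('a::complex_banach \<times> 'b::complex_banach) \<times> 'c::complex_banach.
    (fst (fst f), snd (fst f), snd f))"
proof
  show "surj (\<lambda>f :: ('a \<times> 'b) \<times> 'c. (fst (fst f), snd (fst f), snd f))"
    by (rule surjI[of _ "\<lambda>(a, b, c). ((a, b), c)"]) auto
qed (simp_all add: scaleC_prod_def norm_prod_def add.assoc)

theorem corollary3p11:
  shows "\<exists>e :: nat \<Rightarrow> c0 \<times> ell1 \<times> ell2.
    normalized_basis e \<and> quasi_greedy e \<and> democratic e \<and>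
    (\<exists>c1 c2 :: real. 0 < c1 \<and> c1 \<le> c2 \<and>
      (\<forall>N::nat. N \<ge> 2 \<longrightarrow>
        c1 * ln (real N) \<le> conditionality_constant e N \<and>
        conditionality_constant e N \<le> c2 * ln (real N)))"
proof -
  interpret lifted_basis interleaved 2
    by unfold_locales (simp_all add: normalized_interleaved norm_interleaved_partial_sum_le)
  interpret J: isometric_isomorphism "\<lambda>f :: (c0 \<times> ell1) \<times> ell2. (fst (fst f), snd (fst f), snd f)"
    by (rule isometric_isomorphism_assoc)
  define c1 :: real where "c1 = 1 / 4 / (4 * ln 2)"
  define c2 :: real where "c2 = 15 * 2 / ln 2"
  have bounds: "c1 * ln N \<le> conditionality_constant psi N \<and> conditionality_constant psi N \<le> c2 * ln N"
    if "N \<ge> 2" for N :: nat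
    using le_conditionality_psi[OF _ that interleaved_conditional] conditionality_psi_le[OF that]
    by (simp add: c1_def c2_def)
  have "0 < c1" "c1 \<le> c2" by (simp_all add: c1_def c2_def field_simps)
  with bounds show ?thesis
    using J.normalized_basis_J[OF normalized_psi] J.quasi_greedy_J[OF quasi_greedy_psi]
      J.democratic_J[OF democratic_psi] J.conditionality_constant_J[of psi]
    by (intro exI[of _ "\<lambda>j. (fst (fst (psi j)), snd (fst (psi j)), snd (psi j))"]
        conjI exI[of _ c1] exI[of _ c2]) auto
qed

end
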